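(* For any fixed integers $r\geqslant 2$ and $1\leqslant s_1\leqslant\cdots\leqslant s_r$, $$\mathrm{sat}(n, K_{s_1, \ldots, s_r})=\left(s_1+\cdots+s_{r-1}+\frac{s_r-3}{2}\right)n+O(1),$$ where the implied constant depends only on $s_1,\ldots,s_r$.
   Context: All graphs are finite, undirected, without loops or multiple edges. $K_{s_1,\ldots,s_r}$ denotes the complete $r$-partite graph with parts of sizes $s_1,\ldots,s_r$. For a graph $F$, a graph $G$ is $F$-free if it has no subgraph isomorphic to $F$, and $G$ is $F$-saturated if $G$ is $F$-free and adding any edge joining two nonadjacent vertices of $G$ creates a subgraph isomorphic to $F$. $\mathrm{sat}(n,F)$ is the minimum number of edges of an $F$-saturated graph on $n$ vertices. *)

theory Defs
  imports Complex_Main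
begin

text \<open>A graph is a pair of a vertex set and a set of edges, each edge being a two-element set of
  vertices.\<close>

type_synonym 'a graph = "'a set \<times> 'a set set"

abbreviation verts :: "'a graph \<Rightarrow> 'a set" where
  "verts G \<equiv> fst G"

abbreviation edges :: "'a graph \<Rightarrow> 'a set set" where
  "edges G \<equiv> snd G"

definition simple_graph :: "'a graph \<Rightarrow> bool" where
  "simple_graph G \<longleftrightarrow> finite (verts G) \<and> (\<forall>e\<in>edges G. e \<subseteq> verts G \<and> card e = 2)"

definition subgraph :: "'a graph \<Rightarrow> 'a graph \<Rightarrow> bool" where
  "subgraph H G \<longleftrightarrow> simple_graph H \<and> verts H \<subseteq> verts G \<and> edges H \<subseteq> edges G"

definition isomorphic :: "'a graph \<Rightarrow> 'b graph \<Rightarrow> bool" where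
  "isomorphic G H \<longleftrightarrow> (\<exists>f. bij_betw f (verts G) (verts H) \<and>
     (\<forall>u\<in>verts G. \<forall>v\<in>verts G. {u, v} \<in> edges G \<longleftrightarrow> {f u, f v} \<in> edges H))"

text \<open>Subgraphs here are not necessarily induced.\<close>

definition free :: "'b graph \<Rightarrow> 'a graph \<Rightarrow> bool" where
  "free F G \<longleftrightarrow> \<not> (\<exists>H. subgraph H G \<and> isomorphic H F)"

definition add_edge :: "'a graph \<Rightarrow> 'a \<Rightarrow> 'a \<Rightarrow> 'a graph" where
  "add_edge G u v = (verts G, insert {u, v} (edges G))"

definition saturated :: "'b graph \<Rightarrow> 'a graph \<Rightarrow> bool" where
  "saturated F G \<longleftrightarrow> free F G \<and>
     (\<forall>u\<in>verts G. \<forall>v\<in>verts G. u \<noteq> v \<and> {u, v} \<notin> edges G \<longrightarrow> \<not> free F (add_edge G u v))"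

text \<open>Every graph on \<open>n\<close> vertices is isomorphic to one whose vertices are natural numbers, so taking
  \<open>nat\<close> as the vertex type loses no generality.  The minimum exists whenever \<open>F\<close> has at least one
  edge, since an \<open>F\<close>-free graph on \<open>n\<close> vertices with the largest number of edges is \<open>F\<close>-saturated.\<close>

definition sat :: "nat \<Rightarrow> 'b graph \<Rightarrow> nat" where
  "sat n F = (LEAST m. \<exists>G :: nat graph.
     simple_graph G \<and> card (verts G) = n \<and> saturated F G \<and> card (edges G) = m)"

text \<open>The parts are indexed by \<open>1, \<dots>, r\<close>; the \<open>i\<close>-th part is \<open>{i} \<times> {..<s i}\<close>.\<close>

definition complete_multipartite :: "nat \<Rightarrow> (nat \<Rightarrow> nat) \<Rightarrow> (nat \<times> nat) graph" where
  "complete_multipartite r s =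
     (let V = (SIGMA i:{1..r}. {..<s i})
      in (V, {{u, v} | u v. u \<in> V \<and> v \<in> V \<and> fst u \<noteq> fst v}))"

end

theory Submission
  imports Defs "HOL-Library.Ramsey"
begin

text \<open>Let \<open>F\<close> be the complete multipartite graph, \<open>t\<close> its largest part size and \<open>S\<close> the sum of the
  other part sizes. For the upper bound, join \<open>S - 1\<close> vertices to all vertices
  and put on the rest a maximal graph of maximum degree at most \<open>t - 1\<close> without 4-cycles. It contains
  no copy of \<open>F\<close>, an edge at a vertex of full degree \<open>t - 1\<close> creates one, and only boundedly many
  vertices are not of full degree.

  For the lower bound, call a vertex low if its degree is below a constant \<open>D\<close>, and count an edge
  from a low to a high vertex fully at its low end and an edge between low vertices half at either
  end. If \<open>x\<close> and \<open>y\<close> are low and far apart, the copy of \<open>F\<close> created by \<open>xy\<close> shows that one of them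
  has at least the required weight \<open>(S - 1) + (t - 1)/2\<close>, unless the copy uses an edge between private
  neighbours of \<open>x\<close> and of \<open>y\<close>. In a large sunflower of neighbourhoods, Ramsey's theorem turns many
  exceptional pairs into a copy of \<open>F\<close>. Therefore all but boundedly many low vertices have at least the
  required weight, and those with exactly this weight have only boundedly many high neighbours in
  total. The surplus of the remaining low vertices pays for all but boundedly many high vertices.\<close>

section \<open>Ramsey theorem for pairs and sunflowers\<close>

text \<open>The bound \<open>N\<close> depends only on \<open>c\<close> and \<open>m\<close>, and
  the colour type is arbitrary: bijections carry a subset of \<open>X\<close> and the colours to
  initial segments of the naturals, where the partition theorem applies. Colours are prescribed only
  for \<open>x < y\<close> because the colouring used later is not symmetric.\<close>

lemma ramsey_pairs:
  "\<exists>N. \<forall>(X::nat set) (f::nat \<Rightarrow> nat \<Rightarrow> 'c) C. finite C \<and> card C \<le> c \<and> N \<le> card X \<and>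
     (\<forall>x\<in>X. \<forall>y\<in>X. x < y \<longrightarrow> f x y \<in> C) \<longrightarrow>
     (\<exists>Y\<subseteq>X. card Y = m \<and> (\<exists>z. \<forall>x\<in>Y. \<forall>y\<in>Y. x < y \<longrightarrow> f x y = z))"
proof -
  obtain N :: nat where N: "partn_lst {..<N} (replicate (Suc c) m) 2"
    using ramsey_full by blast
  have main: "\<exists>Y\<subseteq>X. card Y = m \<and> (\<exists>z. \<forall>x\<in>Y. \<forall>y\<in>Y. x < y \<longrightarrow> f x y = z)"
    if C: "finite C" "card C \<le> c" and X: "N \<le> card X"
      and f: "\<And>x y. x \<in> X \<Longrightarrow> y \<in> X \<Longrightarrow> x < y \<Longrightarrow> f x y \<in> C"
    for X :: "nat set" and f :: "nat \<Rightarrow> nat \<Rightarrow> 'c" and C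
  proof -
    obtain X' where X': "X' \<subseteq> X" "card X' = N" "finite X'"
      using obtain_subset_with_card_n[OF X] by metis
    obtain h where h: "bij_betw h {..<N} X'"
      using ex_bij_betw_nat_finite[OF X'(3)] X'(2) by (auto simp: lessThan_atLeast0)
    obtain k where k: "bij_betw k C {..<card C}"
      using ex_bij_betw_finite_nat[OF C(1)] by (auto simp: lessThan_atLeast0)
    \<comment> \<open>The bijection \<open>h\<close> need not be monotone, so a pair is put in order
      only after applying \<open>h\<close>.\<close>
    define F where "F A = k (f (Min (h ` A)) (Max (h ` A)))" for A
    have hX: "h a \<in> X" if "a < N" for a
      using h X'(1) that by (auto simp: bij_betw_def)
    have F_eq: "F {a, b} = k (f (h a) (h b))" if "h a < h b" for a b
      using that by (simp add: F_def)
    have "F \<in> nsets {..<N} 2 \<rightarrow> {..<Suc c}"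
    proof
      fix A assume "A \<in> nsets {..<N} 2"
      then obtain a b where ab: "A = {a, b}" "a < N" "b < N" "a \<noteq> b"
        by (auto simp: nsets_2_eq)
      then have "h a \<noteq> h b"
        using h by (auto simp: bij_betw_def inj_on_def)
      then have "f (Min (h ` A)) (Max (h ` A)) \<in> C"
        using ab hX f by (cases "h a < h b") (auto simp: min_def max_def)
      then show "F A \<in> {..<Suc c}"
        using bij_betw_apply[OF k] C(2) unfolding F_def by fastforce
    qed
    then obtain i H where i: "i < Suc c" and H: "H \<in> nsets {..<N} m" "F ` nsets H 2 \<subseteq> {i}"
      using partn_lstE[OF N] by (metis length_replicate nth_replicate)
    have inj: "inj_on h H"
      using h H(1) by (auto simp: bij_betw_def nsets_def intro: inj_on_subset)
    show ?thesis
    proof (intro exI[of _ "h ` H"] exI[of _ "inv_into C k i"] conjI ballI impI)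
      show "h ` H \<subseteq> X"
        using H(1) hX by (auto simp: nsets_def)
      show "card (h ` H) = m"
        using H(1) card_image[OF inj] by (auto simp: nsets_def)
      fix x y assume "x \<in> h ` H" "y \<in> h ` H" "x < y"
      then obtain a b where ab: "a \<in> H" "b \<in> H" "x = h a" "y = h b" "a \<noteq> b"
        by auto
      have "k (f x y) = i"
        using F_eq[of a b] H(2) ab \<open>x < y\<close> by (auto simp: image_subset_iff)
      moreover have "f x y \<in> C"
        using f hX H(1) ab \<open>x < y\<close> by (auto simp: nsets_def)
      ultimately show "f x y = inv_into C k i"
        using k by (metis bij_betw_imp_inj_on inv_into_f_f)
    qed
  qed
  show ?thesis
  proof (intro exI[of _ N] allI impI)
    fix X :: "nat set" and f :: "nat \<Rightarrow> nat \<Rightarrow> 'c" and C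
    assume "finite C \<and> card C \<le> c \<and> N \<le> card X \<and> (\<forall>x\<in>X. \<forall>y\<in>X. x < y \<longrightarrow> f x y \<in> C)"
    then show "\<exists>Y\<subseteq>X. card Y = m \<and> (\<exists>z. \<forall>x\<in>Y. \<forall>y\<in>Y. x < y \<longrightarrow> f x y = z)"
      using main[of C X f] by blast
  qed
qed

text \<open>Sunflower lemma for indexed families: equal sets at different indices also form a
  sunflower. Either \<open>m\<close> pairwise disjoint sets exist, or the union of a maximal
  disjoint subfamily is a small set meeting all the others. An element of it that lies in many sets
  is then removed from them, and the induction hypothesis applies.\<close>

lemma delta_system:
  "\<exists>N. \<forall>(Y::'a set) (U::'a \<Rightarrow> 'b set). N \<le> card Y \<and> (\<forall>x\<in>Y. finite (U x) \<and> card (U x) \<le> k) \<longrightarrow>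
     (\<exists>X K. X \<subseteq> Y \<and> card X = m \<and> (\<forall>x\<in>X. \<forall>y\<in>X. x \<noteq> y \<longrightarrow> U x \<inter> U y = K))"
proof (induction k)
  case 0
  have main: "\<exists>X K. X \<subseteq> Y \<and> card X = m \<and> (\<forall>x\<in>X. \<forall>y\<in>X. x \<noteq> y \<longrightarrow> U x \<inter> U y = K)"
    if Y: "m \<le> card Y" and U: "\<forall>x\<in>Y. finite (U x) \<and> card (U x) \<le> 0" for Y :: "'a set" and U :: "'a \<Rightarrow> 'b set"
  proof -
    obtain X where "X \<subseteq> Y" "card X = m"
      using obtain_subset_with_card_n[OF Y] by metis
    moreover have "U x = {}" if "x \<in> Y" for x
      using U that by (metis card_0_eq le_zero_eq)
    ultimately show ?thesis
      by (intro exI[of _ X] exI[of _ "{}"]) auto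
  qed
  show ?case
    by (intro exI[of _ m] allI impI, elim conjE, rule main)
next
  case (Suc k)
  then obtain N where N: "\<forall>(Y::'a set) (U::'a \<Rightarrow> 'b set). N \<le> card Y \<and>
     (\<forall>x\<in>Y. finite (U x) \<and> card (U x) \<le> k) \<longrightarrow>
     (\<exists>X K. X \<subseteq> Y \<and> card X = m \<and> (\<forall>x\<in>X. \<forall>y\<in>X. x \<noteq> y \<longrightarrow> U x \<inter> U y = K))" ..
  have main: "\<exists>X K. X \<subseteq> Y \<and> card X = m \<and> (\<forall>x\<in>X. \<forall>y\<in>X. x \<noteq> y \<longrightarrow> U x \<inter> U y = K)"
    if Y: "Suc (m + (m * Suc k) * N) \<le> card Y" and U: "\<And>x. x \<in> Y \<Longrightarrow> finite (U x) \<and> card (U x) \<le> Suc k"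
    for Y :: "'a set" and U :: "'a \<Rightarrow> 'b set"
  proof -
    have finY: "finite Y"
      using Y by (metis card.infinite not_less_eq_eq zero_le)
    define P where "P X \<longleftrightarrow> X \<subseteq> Y \<and> (\<forall>x\<in>X. \<forall>y\<in>X. x \<noteq> y \<longrightarrow> U x \<inter> U y = {})" for X
    have fin: "finite {X. P X}"
      using finY by (rule finite_subset[rotated, OF finite_Pow_iff[THEN iffD2]]) (auto simp: P_def)
    have "P {}"
      by (simp add: P_def)
    then obtain X where X: "P X" and maxX: "\<And>X'. P X' \<Longrightarrow> X \<subseteq> X' \<Longrightarrow> X' = X"
      using finite_has_maximal[OF fin] by (metis empty_iff mem_Collect_eq)
    show ?thesis
    proof (cases "m \<le> card X")
      case True
      then obtain X' where X': "X' \<subseteq> X" "card X' = m"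
        using obtain_subset_with_card_n by metis
      then have "\<forall>x\<in>X'. \<forall>y\<in>X'. x \<noteq> y \<longrightarrow> U x \<inter> U y = {}"
        using X unfolding P_def by blast
      moreover have "X' \<subseteq> Y"
        using X X' by (auto simp: P_def)
      ultimately show ?thesis
        using X'(2) by blast
    next
      case False
      have XY: "X \<subseteq> Y" and finX: "finite X"
        using X finY by (auto simp: P_def intro: finite_subset)
      define V where "V = (\<Union>x\<in>X. U x)"
      have finV: "finite V"
        using XY finX U by (auto simp: V_def)
      have "card V \<le> (\<Sum>x\<in>X. card (U x))"
        unfolding V_def by (rule card_UN_le[OF finX])
      also have "\<dots> \<le> card X * Suc k"
        using U XY by (intro order_trans[OF sum_bounded_above]) auto
      also have "\<dots> \<le> m * Suc k"
        using False by (intro mult_right_mono) auto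
      finally have cardV: "card V \<le> m * Suc k" .
      have meets: "U y \<inter> V \<noteq> {}" if y: "y \<in> Y - X" for y
      proof
        assume "U y \<inter> V = {}"
        then have "P (insert y X)"
          using X y by (auto simp: P_def V_def)
        then show False
          using maxX[of "insert y X"] y by auto
      qed
      \<comment> \<open>The summand \<open>m\<close> in the size bound covers \<open>X\<close>
        itself; the product is what the pigeonhole argument over \<open>V\<close> needs to find an
        element in at least \<open>N\<close> of the sets.\<close>
      have big: "m * Suc k * N < card (Y - X)"
        using Y False card_Diff_subset[OF finX XY] by simp
      have "\<exists>v\<in>V. N \<le> card {y\<in>Y. v \<in> U y}"
      proof (rule ccontr)
        assume "\<not> ?thesis"
        then have less: "card {y\<in>Y. v \<in> U y} \<le> N" if "v \<in> V" for v
          using that by force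
        have "Y - X \<subseteq> (\<Union>v\<in>V. {y\<in>Y. v \<in> U y})"
          using meets by blast
        then have "card (Y - X) \<le> card (\<Union>v\<in>V. {y\<in>Y. v \<in> U y})"
          using finV finY by (intro card_mono) auto
        also have "\<dots> \<le> (\<Sum>v\<in>V. card {y\<in>Y. v \<in> U y})"
          by (rule card_UN_le[OF finV])
        also have "\<dots> \<le> card V * N"
          using less by (intro order_trans[OF sum_bounded_above]) auto
        also have "\<dots> \<le> m * Suc k * N"
          using cardV by (intro mult_right_mono) auto
        finally show False
          using big by simp
      qed
      then obtain v where v: "N \<le> card {y\<in>Y. v \<in> U y}"
        by blast
      have "\<forall>x\<in>{y\<in>Y. v \<in> U y}. finite (U x - {v}) \<and> card (U x - {v}) \<le> k"
        using U by force
      from N[rule_format, OF conjI, OF v, of "\<lambda>x. U x - {v}", OF this] obtain Z K where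
        Z: "Z \<subseteq> {y\<in>Y. v \<in> U y}" "card Z = m"
          "\<forall>x\<in>Z. \<forall>y\<in>Z. x \<noteq> y \<longrightarrow> (U x - {v}) \<inter> (U y - {v}) = K"
        by blast
      have "U x \<inter> U y = insert v K" if "x \<in> Z" "y \<in> Z" "x \<noteq> y" for x y
        using Z(1,3) that by blast
      with Z(1,2) show ?thesis
        by (intro exI[of _ Z] exI[of _ "insert v K"]) auto
    qed
  qed
  show ?case
    by (intro exI[of _ "Suc (m + (m * Suc k) * N)"] allI impI, elim conjE, rule main) simp_all
qed

text \<open>The sets \<open>W x \<inter> K\<close> are made equal as well: in a sunflower of the \<open>U x\<close> only this yields that
  an element of \<open>U x \<inter> W y\<close> lies in \<open>W x\<close>.\<close>

lemma delta_system_trace: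
  "\<exists>N. \<forall>(Y::'a set) (U::'a \<Rightarrow> 'b set) W. N \<le> card Y \<and>
     (\<forall>x\<in>Y. finite (U x) \<and> card (U x) \<le> k) \<longrightarrow>
     (\<exists>X K Z. X \<subseteq> Y \<and> card X = m \<and> finite K \<and> card K \<le> k \<and>
        (\<forall>x\<in>X. \<forall>y\<in>X. x \<noteq> y \<longrightarrow> U x \<inter> U y = K) \<and> (\<forall>x\<in>X. W x \<inter> K = Z))"
proof -
  \<comment> \<open>Two extra members ensure that the kernel lies in some \<open>U x\<close>, so it
    has at most \<open>k\<close> elements; the factor \<open>2 ^ k\<close> pays for the pigeonhole
    over the possible traces on the kernel.\<close>
  define n where "n = Suc (Suc (m * 2 ^ k))"
  obtain N where N: "\<forall>(Y::'a set) (U::'a \<Rightarrow> 'b set). N \<le> card Y \<and>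
     (\<forall>x\<in>Y. finite (U x) \<and> card (U x) \<le> k) \<longrightarrow>
     (\<exists>X K. X \<subseteq> Y \<and> card X = n \<and> (\<forall>x\<in>X. \<forall>y\<in>X. x \<noteq> y \<longrightarrow> U x \<inter> U y = K))"
    using delta_system[where 'a='a and 'b='b and k=k and m=n] by (elim exE)
  have main: "\<exists>X K Z. X \<subseteq> Y \<and> card X = m \<and> finite K \<and> card K \<le> k \<and>
        (\<forall>x\<in>X. \<forall>y\<in>X. x \<noteq> y \<longrightarrow> U x \<inter> U y = K) \<and> (\<forall>x\<in>X. W x \<inter> K = Z)"
    if Y: "N \<le> card Y" and U: "\<forall>x\<in>Y. finite (U x) \<and> card (U x) \<le> k"
    for Y :: "'a set" and U W :: "'a \<Rightarrow> 'b set"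
  proof -
    obtain X K where X: "X \<subseteq> Y" "card X = n" "\<forall>x\<in>X. \<forall>y\<in>X. x \<noteq> y \<longrightarrow> U x \<inter> U y = K"
      using N[rule_format, OF conjI, OF Y U] by blast
    have finX: "finite X"
      using X(2) by (metis card.infinite n_def nat.distinct(1))
    have "2 \<le> card X"
      using X(2) by (simp add: n_def)
    then obtain x y where xy: "x \<in> X" "y \<in> X" "x \<noteq> y"
      by (metis card_le_Suc0_iff_eq finX not_less_eq_eq numeral_2_eq_2)
    then have "K \<subseteq> U x" "finite (U x)" "card (U x) \<le> k"
      using X U by blast+
    then have K: "finite K" "card K \<le> k"
      by (auto intro: finite_subset order_trans[OF card_mono])
    obtain Z where "Z \<in> Pow K" and Z: "card X \<le> card ((\<lambda>x. W x \<inter> K) -` {Z} \<inter> X) * card (Pow K)"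
      using pigeonhole_card[of "\<lambda>x. W x \<inter> K" X "Pow K"] finX K by auto
    define X1 where "X1 = (\<lambda>x. W x \<inter> K) -` {Z} \<inter> X"
    have "m * 2 ^ k \<le> card X"
      using X(2) by (simp add: n_def)
    also have "\<dots> \<le> card X1 * card (Pow K)"
      using Z by (simp add: X1_def)
    also have "\<dots> \<le> card X1 * 2 ^ k"
      using K by (simp add: card_Pow)
    finally have "m \<le> card X1"
      by simp
    then obtain X2 where X2: "X2 \<subseteq> X1" "card X2 = m"
      using obtain_subset_with_card_n by metis
    then have X2': "X2 \<subseteq> X" "\<forall>x\<in>X2. W x \<inter> K = Z"
      by (auto simp: X1_def)
    moreover from this have "\<forall>x\<in>X2. \<forall>y\<in>X2. x \<noteq> y \<longrightarrow> U x \<inter> U y = K"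
      using X(3) by blast
    moreover have "X2 \<subseteq> Y"
      using X2'(1) X(1) by simp
    ultimately show ?thesis
      using X2(2) K by (intro exI conjI) assumption+
  qed
  show ?thesis
  proof (rule exI[of _ N], rule allI, rule allI, rule allI, rule impI, elim conjE)
    fix Y :: "'a set" and U W :: "'a \<Rightarrow> 'b set"
    assume "N \<le> card Y" "\<forall>x\<in>Y. finite (U x) \<and> card (U x) \<le> k"
    from main[OF this, of W] show "\<exists>X K Z. X \<subseteq> Y \<and> card X = m \<and> finite K \<and> card K \<le> k \<and>
        (\<forall>x\<in>X. \<forall>y\<in>X. x \<noteq> y \<longrightarrow> U x \<inter> U y = K) \<and> (\<forall>x\<in>X. W x \<inter> K = Z)" .
  qed
qed

section \<open>Copies through a new edge\<close>

definition multipartite_verts :: "nat \<Rightarrow> (nat \<Rightarrow> nat) \<Rightarrow> (nat \<times> nat) set" where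
  "multipartite_verts r s = (SIGMA i:{1..r}. {..<s i})"

text \<open>A copy, not necessarily induced, described by its vertex map. The edge condition already
  keeps the image among the vertices of the graph, since every vertex of a complete multipartite
  graph with at least two nonempty parts has a neighbour.\<close>

definition embeds :: "nat \<Rightarrow> (nat \<Rightarrow> nat) \<Rightarrow> 'a set set \<Rightarrow> (nat \<times> nat \<Rightarrow> 'a) \<Rightarrow> bool" where
  "embeds r s E \<phi> \<longleftrightarrow> inj_on \<phi> (multipartite_verts r s) \<and>
     (\<forall>a\<in>multipartite_verts r s. \<forall>b\<in>multipartite_verts r s. fst a \<noteq> fst b \<longrightarrow> {\<phi> a, \<phi> b} \<in> E)"

definition nb :: "'a set set \<Rightarrow> 'a \<Rightarrow> 'a set" where
  "nb E x = {y. {x, y} \<in> E}"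

definition low :: "'a set \<Rightarrow> 'a set set \<Rightarrow> nat \<Rightarrow> 'a set" where
  "low W E D = {x\<in>W. card (nb E x) < D}"

text \<open>Twice the weight described above, so as to stay in \<open>nat\<close>.\<close>

definition weight :: "'a set \<Rightarrow> 'a set set \<Rightarrow> nat \<Rightarrow> 'a \<Rightarrow> nat" where
  "weight W E D x = 2 * card (nb E x - low W E D) + card (nb E x \<inter> low W E D)"

text \<open>Walks of length at most 2 whose middle vertex, if any, is low. This keeps the set
  bounded for low \<open>x\<close> and makes the relation symmetric.\<close>

definition reach :: "'a set \<Rightarrow> 'a set set \<Rightarrow> nat \<Rightarrow> 'a \<Rightarrow> 'a set" where
  "reach W E D x = insert x (nb E x \<union> (\<Union>u\<in>nb E x \<inter> low W E D. nb E u))"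

locale part_sizes =
  fixes r :: nat and s :: "nat \<Rightarrow> nat"
  assumes two_parts: "2 \<le> r"
    and size_pos: "i \<in> {1..r} \<Longrightarrow> 1 \<le> s i"
    and size_le: "i \<in> {1..r} \<Longrightarrow> s i \<le> s r"
begin

abbreviation V :: "(nat \<times> nat) set" where "V \<equiv> multipartite_verts r s"

definition S :: nat where "S = (\<Sum>i = 1..r - 1. s i)"

abbreviation t :: nat where "t \<equiv> s r"

text \<open>Twice the coefficient of \<open>n\<close> in the theorem.\<close>

definition k2 :: nat where "k2 = 2 * (S - 1) + (t - 1)"

lemma t_pos: "1 \<le> t"
  using size_pos[of r] two_parts by simp

lemma S_pos: "1 \<le> S"
proof -
  have "s 1 \<le> S"
    unfolding S_def using two_parts by (intro member_le_sum) auto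
  then show ?thesis
    using size_pos[of 1] two_parts by simp
qed

lemma finite_V [simp]: "finite V"
  by (auto simp: multipartite_verts_def)

lemma card_V: "card V = S + t"
proof -
  have "{1..r} = insert r {1..r - 1}"
    using two_parts by auto
  moreover have "r \<notin> {1..r - 1}"
    using two_parts by auto
  ultimately show ?thesis
    by (simp add: multipartite_verts_def S_def)
qed

lemma card_part: "a \<in> V \<Longrightarrow> card {c \<in> V. fst c = fst a} \<le> t"
proof -
  assume "a \<in> V"
  then have "fst a \<in> {1..r}" and "{c \<in> V. fst c = fst a} = {fst a} \<times> {..<s (fst a)}"
    by (auto simp: multipartite_verts_def)
  then show ?thesis
    using size_le[of "fst a"] by (simp add: card_cartesian_product)
qed

end

section \<open>Neighbourhoods and double counting in a finite graph\<close>

locale edge_set =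
  fixes W :: "'a set" and E :: "'a set set"
  assumes finite_W: "finite W"
    and edge: "e \<in> E \<Longrightarrow> e \<subseteq> W \<and> card e = 2"
begin

lemma nb_sym: "y \<in> nb E x \<longleftrightarrow> x \<in> nb E y"
  by (simp add: nb_def insert_commute)

lemma nb_subset: "nb E x \<subseteq> W"
  using edge by (auto simp: nb_def)

lemma finite_nb [simp]: "finite (nb E x)"
  using nb_subset finite_W by (rule finite_subset)

lemma nb_irrefl: "x \<notin> nb E x"
  using edge[of "{x, x}"] by (auto simp: nb_def)

lemma finite_E: "finite E"
  using edge finite_W by (intro finite_subset[of E "Pow W"]) auto

lemma low_subset: "low W E D \<subseteq> W"
  by (auto simp: low_def)

lemma finite_low: "finite (low W E D)"
  using low_subset finite_W by (rule finite_subset)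

lemma finite_reach: "finite (reach W E D x)"
  by (auto simp: reach_def)

lemma reach_sym: "y \<in> reach W E D x \<longleftrightarrow> x \<in> reach W E D y"
  using nb_sym by (auto simp: reach_def)

lemma card_reach: "x \<in> low W E D \<Longrightarrow> card (reach W E D x) \<le> Suc (D + D * D)"
proof -
  assume x: "x \<in> low W E D"
  then have D: "card (nb E x) \<le> D"
    by (simp add: low_def)
  have "card (\<Union>u\<in>nb E x \<inter> low W E D. nb E u) \<le> (\<Sum>u\<in>nb E x \<inter> low W E D. card (nb E u))"
    by (rule card_UN_le) simp
  also have "\<dots> \<le> card (nb E x \<inter> low W E D) * D"
    using sum_bounded_above[of "nb E x \<inter> low W E D" "\<lambda>u. card (nb E u)" D]
    by (simp add: low_def less_imp_le)
  also have "\<dots> \<le> D * D"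
    using D card_mono[OF finite_nb, of "nb E x \<inter> low W E D" x] by (intro mult_right_mono) auto
  finally have "card (nb E x \<union> (\<Union>u\<in>nb E x \<inter> low W E D. nb E u)) \<le> D + D * D"
    using D by (intro order_trans[OF card_Un_le]) auto
  then show ?thesis
    unfolding reach_def by (intro order_trans[OF card_insert_le_m1]) auto
qed

lemma sum_degrees: "(\<Sum>x\<in>W. card (nb E x)) = 2 * card E"
proof -
  have "(\<Sum>x\<in>W. card {e\<in>E. x \<in> e}) = (\<Sum>e\<in>E. 2)"
  proof (rule sum_multicount_gen[OF finite_W finite_E])
    show "\<forall>e\<in>E. card {x\<in>W. x \<in> e} = 2"
    proof
      fix e assume e: "e \<in> E"
      then have "{x\<in>W. x \<in> e} = e"
        using edge by auto
      then show "card {x\<in>W. x \<in> e} = 2"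
        using edge[OF e] by simp
    qed
  qed
  moreover have "card {e\<in>E. x \<in> e} = card (nb E x)" for x
  proof (rule bij_betw_same_card[symmetric])
    show "bij_betw (\<lambda>y. {x, y}) (nb E x) {e\<in>E. x \<in> e}"
    proof (rule bij_betw_imageI)
      show "inj_on (\<lambda>y. {x, y}) (nb E x)"
        by (auto simp: inj_on_def doubleton_eq_iff)
      have "e \<in> (\<lambda>y. {x, y}) ` nb E x" if e: "e \<in> E" "x \<in> e" for e
      proof -
        obtain u v where "e = {u, v}"
          using edge[OF e(1)] by (auto simp: card_2_iff)
        then obtain y where "e = {x, y}"
          using e(2) by auto
        then show ?thesis
          using e(1) by (auto simp: nb_def)
      qed
      then show "(\<lambda>y. {x, y}) ` nb E x = {e\<in>E. x \<in> e}"
        by (auto simp: nb_def)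
    qed
  qed
  ultimately show ?thesis
    by simp
qed

lemma card_nb_split: "card (nb E x) = card (nb E x - A) + card (nb E x \<inter> A)"
proof -
  have "card (nb E x) = card ((nb E x - A) \<union> (nb E x \<inter> A))"
    by (rule arg_cong[of _ _ card]) auto
  also have "\<dots> = card (nb E x - A) + card (nb E x \<inter> A)"
    by (intro card_Un_disjoint) auto
  finally show ?thesis .
qed

text \<open>Both sums count the adjacent pairs with one vertex in \<open>A\<close> and the other in
  \<open>B\<close>. This transfers edge counts between low and high ends in the lower bound.\<close>

lemma sum_nb_swap:
  assumes "A \<subseteq> W" "B \<subseteq> W"
  shows "(\<Sum>x\<in>A. card (nb E x \<inter> B)) = (\<Sum>y\<in>B. card (nb E y \<inter> A))"
proof -
  have "finite A" "finite B"
    using assms finite_W by (auto intro: finite_subset)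
  then have "(\<Sum>x\<in>A. card {y\<in>B. y \<in> nb E x}) = (\<Sum>y\<in>B. card {x\<in>A. y \<in> nb E x})"
    by (intro sum_multicount_gen) auto
  moreover have "{y\<in>B. y \<in> nb E x} = nb E x \<inter> B" "{z\<in>A. x \<in> nb E z} = nb E x \<inter> A" for x
    using nb_sym by auto
  ultimately show ?thesis
    by simp
qed

end

locale saturated_edge_set = part_sizes r s + edge_set W E
  for r :: nat and s :: "nat \<Rightarrow> nat" and W :: "'a set" and E :: "'a set set" +
  assumes no_copy: "\<not> embeds r s E \<phi>"
    and copy: "x \<in> W \<Longrightarrow> y \<in> W \<Longrightarrow> x \<noteq> y \<Longrightarrow> {x, y} \<notin> E \<Longrightarrow>
      \<exists>\<phi>. embeds r s (insert {x, y} E) \<phi>"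
begin

text \<open>A copy avoiding the new edge would already be a copy in \<open>E\<close>. The names
  \<open>a\<close> and \<open>b\<close> can be exchanged, so the preimages may be matched with
  \<open>x\<close> and \<open>y\<close> in this order.\<close>

lemma copy_at_edge:
  assumes "x \<in> W" "y \<in> W" "x \<noteq> y" "{x, y} \<notin> E"
  obtains \<phi> a b where "embeds r s (insert {x, y} E) \<phi>" "a \<in> V" "b \<in> V" "fst a \<noteq> fst b"
    "\<phi> a = x" "\<phi> b = y"
proof -
  obtain \<phi> where \<phi>: "embeds r s (insert {x, y} E) \<phi>"
    using copy[OF assms] by blast
  moreover have "\<not> embeds r s E \<phi>"
    by (rule no_copy)
  ultimately obtain a b where ab: "a \<in> V" "b \<in> V" "fst a \<noteq> fst b" "{\<phi> a, \<phi> b} = {x, y}"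
    unfolding embeds_def by blast
  then consider "\<phi> a = x" "\<phi> b = y" | "\<phi> b = x" "\<phi> a = y"
    by (auto simp: doubleton_eq_iff)
  then show ?thesis
  proof cases
    case 1
    then show ?thesis
      using that[OF \<phi> ab(1-3)] by simp
  next
    case 2
    then show ?thesis
      using that[OF \<phi> ab(2,1) ab(3)[symmetric]] by simp
  qed
qed

text \<open>By injectivity only the pair \<open>{a, b}\<close> is mapped onto the new edge, so all
  other edges of the copy are old.\<close>

lemma embeds_old_edge:
  assumes "embeds r s (insert {x, y} E) \<phi>" "a \<in> V" "b \<in> V" "\<phi> a = x" "\<phi> b = y"
    "c \<in> V" "d \<in> V" "fst c \<noteq> fst d" "{c, d} \<noteq> {a, b}"
  shows "\<phi> d \<in> nb E (\<phi> c)"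
proof -
  have inj: "inj_on \<phi> V" and "{\<phi> c, \<phi> d} \<in> insert {x, y} E"
    using assms by (auto simp: embeds_def)
  moreover have "{\<phi> c, \<phi> d} \<noteq> {x, y}"
    using assms inj by (auto simp: doubleton_eq_iff dest: inj_onD)
  ultimately show ?thesis
    by (simp add: nb_def)
qed

text \<open>Counting the copy gives \<open>weight x \<ge> k2\<close>; equality forces the whole part of \<open>y\<close> to consist of
  low vertices, so that all high neighbours of \<open>x\<close> are common to \<open>x\<close> and \<open>y\<close>.\<close>

lemma weight_of_centre:
  fixes D :: nat and x y :: 'a
  defines "L \<equiv> low W E D"
  assumes \<phi>: "embeds r s (insert {x, y} E) \<phi>" and ab: "a \<in> V" "b \<in> V" "fst a \<noteq> fst b"
      "\<phi> a = x" "\<phi> b = y"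
    and L: "x \<in> L" "y \<in> L" and K: "reach W E D x \<inter> reach W E D y = K" "K \<inter> L = {}"
      "nb E x \<inter> K = nb E y \<inter> K"
    and le: "weight W E D x \<le> k2"
    and part: "\<And>c. c \<in> V \<Longrightarrow> fst c = fst a \<Longrightarrow> c \<noteq> a \<Longrightarrow> \<phi> c \<in> K"
  shows "weight W E D x = k2 \<and> nb E x - L \<subseteq> K"
proof -
  have inj: "inj_on \<phi> V"
    using \<phi> by (simp add: embeds_def)
  note old = embeds_old_edge[OF \<phi> ab(1,2,4,5)]
  have nbx: "\<phi> c \<in> nb E x" if "c \<in> V" "fst c \<noteq> fst a" "c \<noteq> b" for c
    using old[of a c] that ab by (auto simp: doubleton_eq_iff)
  have nby: "\<phi> c \<in> nb E y" if "c \<in> V" "fst c \<noteq> fst b" "c \<noteq> a" for c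
    using old[of b c] that ab by (auto simp: doubleton_eq_iff)
  \<comment> \<open>The vertices of \<open>B\<close> other than \<open>b\<close> are low neighbours
    of \<open>x\<close> and count once in the weight; those of \<open>R\<close> turn out to be high
    neighbours and count twice. The total is at least
    \<open>2 * (S + t - 1 - card B) + (card B - 1)\<close>, which is
    \<open>k2 + (t - card B)\<close>.\<close>
  define B where "B = {c\<in>V. fst c = fst b \<and> \<phi> c \<in> L}"
  define R where "R = V - {a} - B"
  have finB: "finite B" and BV: "B \<subseteq> V" and bB: "b \<in> B" and aB: "a \<notin> B"
    using ab L by (auto simp: B_def)
  have B_le: "card B \<le> t"
    using card_part[OF ab(2)] by (rule order_trans[rotated]) (auto simp: B_def intro: card_mono)
  have B_pos: "1 \<le> card B"
    using bB finB by (metis One_nat_def Suc_leI card_gt_0_iff empty_iff)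
  have R_K: "\<phi> c \<in> nb E x \<inter> K" if c: "c \<in> R" "fst c \<noteq> fst b" for c
  proof (cases "fst c = fst a")
    \<comment> \<open>In the copy a vertex of the part of \<open>x\<close> is adjacent to
      \<open>y\<close> only; being in \<open>K\<close>, it is a neighbour of \<open>x\<close> as
      well because \<open>x\<close> and \<open>y\<close> have the same trace on
      \<open>K\<close>.\<close>
    case True
    have "c \<in> V" "c \<noteq> a"
      using c by (auto simp: R_def)
    then have "\<phi> c \<in> K" "\<phi> c \<in> nb E y"
      using True c(2) part nby by blast+
    then show ?thesis
      using K(3) by blast
  next
    case False
    have "c \<in> V" "c \<noteq> a" "c \<noteq> b"
      using c by (auto simp: R_def)
    then have "\<phi> c \<in> nb E x" "\<phi> c \<in> nb E y"
      using False c(2) nbx nby by blast+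
    then show ?thesis
      using K(1) by (auto simp: reach_def)
  qed
  have R_H: "\<phi> ` R \<subseteq> nb E x - L"
  proof
    fix z assume "z \<in> \<phi> ` R"
    then obtain c where c: "c \<in> R" "z = \<phi> c"
      by blast
    show "z \<in> nb E x - L"
    proof (cases "fst c = fst b")
      case True
      then have "c \<noteq> b" "fst c \<noteq> fst a" "c \<in> V" "\<phi> c \<notin> L"
        using c bB ab by (auto simp: R_def B_def)
      then show ?thesis
        using nbx c by blast
    next
      case False
      then show ?thesis
        using R_K c K(2) by blast
    qed
  qed
  have "card (\<phi> ` R) = card R"
    using inj by (intro card_image) (auto simp: R_def intro: inj_on_subset)
  also have "\<dots> = S + t - 1 - card B"
  proof -
    have "B \<subseteq> V - {a}"
      using BV aB by auto
    then show ?thesis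
      unfolding R_def using card_V ab(1) finB by (simp add: card_Diff_subset)
  qed
  finally have card_R: "card (\<phi> ` R) = S + t - 1 - card B" .
  then have H_ge: "S + t - 1 - card B \<le> card (nb E x - L)"
    using card_mono[OF _ R_H] by simp
  have "card (\<phi> ` (B - {b})) = card B - 1"
    using inj BV bB finB by (subst card_image) (auto intro: inj_on_subset)
  moreover have "\<phi> ` (B - {b}) \<subseteq> nb E x \<inter> L"
    using nbx ab(3) unfolding B_def by fastforce
  ultimately have L_ge: "card B - 1 \<le> card (nb E x \<inter> L)"
    using card_mono[of "nb E x \<inter> L" "\<phi> ` (B - {b})"] by simp
  have wx: "weight W E D x = 2 * card (nb E x - L) + card (nb E x \<inter> L)"
    by (simp add: weight_def L_def)
  have eqs: "card B = t" "weight W E D x = k2" "card (nb E x - L) = S + t - 1 - card B"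
    using H_ge L_ge le wx B_le B_pos S_pos unfolding k2_def by linarith+
  \<comment> \<open>Equality in the count leaves no vertex of the part of \<open>y\<close> in
    \<open>R\<close>, so \<open>R_K\<close> covers all of \<open>R\<close>.\<close>
  have "{c\<in>V. fst c = fst b} = B"
    using card_part[OF ab(2)] eqs(1) by (intro card_seteq[symmetric]) (auto simp: B_def)
  then have "fst c \<noteq> fst b" if "c \<in> R" for c
    using that by (auto simp: R_def)
  then have "\<phi> ` R \<subseteq> K"
    using R_K by blast
  moreover have "\<phi> ` R = nb E x - L"
    using R_H eqs(3) card_R by (intro card_seteq) auto
  ultimately show ?thesis
    using eqs by simp
qed

text \<open>By \<open>weight_of_centre\<close>, applied to \<open>x\<close> and with exchanged roles
  to \<open>y\<close>, each of the two parts through \<open>x\<close> and \<open>y\<close> contains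
  a vertex mapped outside \<open>K\<close>. The one in the part of \<open>y\<close> gives the
  private neighbour \<open>u\<close> of \<open>x\<close>, the one in the part of \<open>x\<close>
  gives \<open>v\<close>. All other parts consist of common neighbours of \<open>x\<close> and
  \<open>y\<close>, which lie in \<open>K\<close>. These are the data that Ramsey's theorem makes
  uniform.\<close>

lemma bad_pair:
  fixes D :: nat and x y :: 'a
  defines "L \<equiv> low W E D"
  assumes xy: "x \<in> L" "y \<in> L" "x \<noteq> y"
    and K: "reach W E D x \<inter> reach W E D y = K" "K \<inter> L = {}" "nb E x \<inter> K = nb E y \<inter> K"
    and le: "weight W E D x \<le> k2" "weight W E D y \<le> k2"
    and bad: "\<not> (weight W E D x = k2 \<and> nb E x - L \<subseteq> K)"
      "\<not> (weight W E D y = k2 \<and> nb E y - L \<subseteq> K)"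
  shows "\<exists>i j g u v. i \<in> {1..r} \<and> j \<in> {1..r} \<and> i \<noteq> j \<and> u \<in> nb E x - K \<and> v \<in> nb E y - K \<and>
    {u, v} \<in> E \<and> inj_on g {c\<in>V. fst c \<noteq> i \<and> fst c \<noteq> j} \<and>
    (\<forall>c\<in>V. fst c \<noteq> i \<and> fst c \<noteq> j \<longrightarrow> g c \<in> K \<and> {g c, u} \<in> E \<and> {g c, v} \<in> E \<and>
      (\<forall>d\<in>V. fst d \<noteq> i \<and> fst d \<noteq> j \<and> fst c \<noteq> fst d \<longrightarrow> {g c, g d} \<in> E))"
proof -
  have "x \<in> W" "y \<in> W"
    using xy low_subset by (auto simp: L_def)
  moreover have "{x, y} \<notin> E"
  proof
    assume "{x, y} \<in> E"
    then have "y \<in> reach W E D x \<inter> reach W E D y"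
      by (auto simp: reach_def nb_def)
    then show False
      using K xy by blast
  qed
  ultimately obtain \<phi> a b where \<phi>: "embeds r s (insert {x, y} E) \<phi>" and
    ab: "a \<in> V" "b \<in> V" "fst a \<noteq> fst b" "\<phi> a = x" "\<phi> b = y"
    using copy_at_edge[OF _ _ xy(3)] by metis
  have inj: "inj_on \<phi> V"
    using \<phi> by (simp add: embeds_def)
  note old = embeds_old_edge[OF \<phi> ab(1,2,4,5)]
  have nbx: "\<phi> c \<in> nb E x" if "c \<in> V" "fst c \<noteq> fst a" "c \<noteq> b" for c
    using old[of a c] that ab by (auto simp: doubleton_eq_iff)
  have nby: "\<phi> c \<in> nb E y" if "c \<in> V" "fst c \<noteq> fst b" "c \<noteq> a" for c
    using old[of b c] that ab by (auto simp: doubleton_eq_iff)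
  have "\<not> (\<forall>c. c \<in> V \<longrightarrow> fst c = fst a \<longrightarrow> c \<noteq> a \<longrightarrow> \<phi> c \<in> K)"
  proof
    assume all: "\<forall>c. c \<in> V \<longrightarrow> fst c = fst a \<longrightarrow> c \<noteq> a \<longrightarrow> \<phi> c \<in> K"
    have "weight W E D x = k2 \<and> nb E x - low W E D \<subseteq> K"
      by (rule weight_of_centre[OF \<phi> ab xy(1,2)[unfolded L_def] K(1) K(2,3)[unfolded L_def] le(1)])
        (use all in blast)
    then show False
      using bad(1) by (simp add: L_def)
  qed
  then obtain c where c: "c \<in> V" "fst c = fst a" "c \<noteq> a" "\<phi> c \<notin> K"
    by blast
  have \<phi>': "embeds r s (insert {y, x} E) \<phi>"
    using \<phi> by (simp add: insert_commute)
  have K1: "reach W E D y \<inter> reach W E D x = K"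
    using K(1) by (simp add: Int_commute)
  have "\<not> (\<forall>c. c \<in> V \<longrightarrow> fst c = fst b \<longrightarrow> c \<noteq> b \<longrightarrow> \<phi> c \<in> K)"
  proof
    assume all: "\<forall>c. c \<in> V \<longrightarrow> fst c = fst b \<longrightarrow> c \<noteq> b \<longrightarrow> \<phi> c \<in> K"
    have "weight W E D y = k2 \<and> nb E y - low W E D \<subseteq> K"
      by (rule weight_of_centre[OF \<phi>' ab(2,1) ab(3)[symmetric] ab(5,4) xy(2,1)[unfolded L_def] K1
        K(2)[unfolded L_def] K(3)[symmetric] le(2)])
        (use all in blast)
    then show False
      using bad(2) by (simp add: L_def)
  qed
  then obtain d where d: "d \<in> V" "fst d = fst b" "d \<noteq> b" "\<phi> d \<notin> K"
    by blast
  have edge': "{\<phi> p, \<phi> q} \<in> E" if "p \<in> V" "q \<in> V" "fst p \<noteq> fst q" "{p, q} \<noteq> {a, b}" for p q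
    using old[of p q] that by (simp add: nb_def)
  show ?thesis
  proof (rule exI[of _ "fst a"], rule exI[of _ "fst b"], rule exI[of _ \<phi>], rule exI[of _ "\<phi> d"],
      rule exI[of _ "\<phi> c"], intro conjI ballI impI)
    show "fst a \<in> {1..r}" "fst b \<in> {1..r}"
      using ab by (auto simp: multipartite_verts_def)
    show "fst a \<noteq> fst b"
      by (fact ab)
    show "\<phi> d \<in> nb E x - K" "\<phi> c \<in> nb E y - K"
      using c d nbx[of d] nby[of c] ab by auto
    show "{\<phi> d, \<phi> c} \<in> E"
      using c d ab by (intro edge') (auto simp: doubleton_eq_iff)
    show "inj_on \<phi> {c \<in> V. fst c \<noteq> fst a \<and> fst c \<noteq> fst b}"
      using inj by (rule inj_on_subset) auto
    fix e assume e: "e \<in> V" "fst e \<noteq> fst a \<and> fst e \<noteq> fst b"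
    then have "e \<noteq> a" "e \<noteq> b"
      by auto
    then have "\<phi> e \<in> nb E x" "\<phi> e \<in> nb E y"
      using nbx nby e by blast+
    then show "\<phi> e \<in> K"
      using K(1) by (auto simp: reach_def)
    show "{\<phi> e, \<phi> d} \<in> E" "{\<phi> e, \<phi> c} \<in> E"
      using e c(1,2) d(1,2) by (intro edge'; auto simp: doubleton_eq_iff)+
    fix f assume "f \<in> V" "fst f \<noteq> fst a \<and> fst f \<noteq> fst b \<and> fst e \<noteq> fst f"
    then show "{\<phi> e, \<phi> f} \<in> E"
      using e by (intro edge'; auto simp: doubleton_eq_iff)
  qed
qed

end

section \<open>The lower bound\<close>

context part_sizes
begin

text \<open>Otherwise every pair in \<open>X\<close> is as in \<open>bad_pair\<close>. On a
  homogeneous set of \<open>2 * t\<close> vertices the parts \<open>i\<close>, \<open>j\<close>, the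
  map \<open>g\<close> and the positions of the private neighbours are constant. The private
  neighbours of the first \<open>t\<close> and of the last \<open>t\<close> vertices then span a
  complete bipartite graph, which together with \<open>g\<close> is a copy in
  \<open>E\<close>.\<close>

lemma kernel_contains_high_nb:
  "\<exists>M. \<forall>W (E :: nat set set) X K Z. saturated_edge_set r s W E \<and> X \<subseteq> low W E D \<and>
     (\<forall>x\<in>X. weight W E D x \<le> k2) \<and> finite K \<and> card K \<le> k \<and>
     (\<forall>x\<in>X. \<forall>y\<in>X. x \<noteq> y \<longrightarrow> reach W E D x \<inter> reach W E D y = K) \<and>
     (\<forall>x\<in>X. nb E x \<inter> K = Z) \<and> M \<le> card X \<longrightarrow>
     (\<exists>x\<in>X. weight W E D x = k2 \<and> nb E x - low W E D \<subseteq> K)"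
proof -
  \<comment> \<open>A colour consists of two part indices, a map from \<open>V\<close> to
    \<open>K\<close> with the default value 0 added, and two positions below
    \<open>D\<close>.\<close>
  define colours where "colours = r * (r * (Suc k ^ card V * (D * D)))"
  obtain N where N: "\<forall>(X::nat set) (f::nat \<Rightarrow> nat \<Rightarrow> nat \<times> nat \<times> (nat \<times> nat \<Rightarrow> nat) \<times> nat \<times> nat) C.
     finite C \<and> card C \<le> colours \<and> N \<le> card X \<and>
     (\<forall>x\<in>X. \<forall>y\<in>X. x < y \<longrightarrow> f x y \<in> C) \<longrightarrow>
     (\<exists>Y\<subseteq>X. card Y = 2 * t \<and> (\<exists>z. \<forall>x\<in>Y. \<forall>y\<in>Y. x < y \<longrightarrow> f x y = z))"
    using ramsey_pairs[where c = colours and m = "2 * t"] by (elim exE)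
  \<comment> \<open>The first summand serves Ramsey's theorem, the second exceeds the bound of
    \<open>card_reach\<close>.\<close>
  define M where "M = N + Suc (Suc (Suc (D + D * D)))"
  show ?thesis
  proof (rule exI[of _ M], intro allI impI, elim conjE, rule ccontr)
    fix W and E :: "nat set set" and X K Z
    assume sat: "saturated_edge_set r s W E" and XL: "X \<subseteq> low W E D"
      and le: "\<forall>x\<in>X. weight W E D x \<le> k2" and finK: "finite K" and cardK: "card K \<le> k"
      and sun: "\<forall>x\<in>X. \<forall>y\<in>X. x \<noteq> y \<longrightarrow> reach W E D x \<inter> reach W E D y = K"
      and Z: "\<forall>x\<in>X. nb E x \<inter> K = Z" and MX: "M \<le> card X"
      and "\<not> (\<exists>x\<in>X. weight W E D x = k2 \<and> nb E x - low W E D \<subseteq> K)"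
    then have bad: "\<not> (weight W E D x = k2 \<and> nb E x - low W E D \<subseteq> K)" if "x \<in> X" for x
      using that by blast
    interpret saturated_edge_set r s W E
      by (fact sat)
    have finX: "finite X"
      using XL finite_low by (rule finite_subset)
    \<comment> \<open>Every member of \<open>X\<close> reaches all of \<open>K\<close>, so by
      symmetry a low vertex of \<open>K\<close> would reach all of \<open>X\<close>, too many
      vertices for \<open>card_reach\<close>.\<close>
    have KL: "K \<inter> low W E D = {}"
    proof (rule ccontr)
      assume "K \<inter> low W E D \<noteq> {}"
      then obtain v where v: "v \<in> K" "v \<in> low W E D"
        by blast
      have "X \<subseteq> reach W E D v"
      proof
        fix x assume x: "x \<in> X"
        have "card (X - {x}) \<noteq> 0"
          using x MX finX by (simp add: M_def)
        then have "X - {x} \<noteq> {}"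
          by force
        then obtain y where "y \<in> X" "y \<noteq> x"
          by blast
        then have "v \<in> reach W E D x"
          using sun x v(1) by blast
        then show "x \<in> reach W E D v"
          using reach_sym by blast
      qed
      then have "card X \<le> card (reach W E D v)"
        by (rule card_mono[OF finite_reach])
      also have "\<dots> \<le> Suc (D + D * D)"
        by (rule card_reach[OF v(2)])
      finally have "card X \<le> Suc (D + D * D)" .
      then show False
        using MX by (simp add: M_def)
    qed
    \<comment> \<open>Recording a neighbour by its position instead of its name keeps the number of
      colours bounded.\<close>
    define e where "e x p = sorted_list_of_set (nb E x) ! p" for x p
    have e_ex: "\<exists>p<D. e x p = u" if "x \<in> X" "u \<in> nb E x" for x u
    proof -
      have "u \<in> set (sorted_list_of_set (nb E x))"
        using that(2) by simp
      then obtain p where "p < card (nb E x)" "e x p = u"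
        unfolding in_set_conv_nth e_def by auto
      moreover have "card (nb E x) < D"
        using that(1) XL by (auto simp: low_def)
      ultimately show ?thesis
        by (intro exI[of _ p]) simp
    qed
    define P where "P x y z \<longleftrightarrow> (case z of (i, j, g, p, q) \<Rightarrow> i \<noteq> j \<and> e x p \<in> nb E x - K \<and>
        e y q \<in> nb E y - K \<and> {e x p, e y q} \<in> E \<and> inj_on g {c\<in>V. fst c \<noteq> i \<and> fst c \<noteq> j} \<and>
        (\<forall>c\<in>V. fst c \<noteq> i \<and> fst c \<noteq> j \<longrightarrow> g c \<in> K \<and> {g c, e x p} \<in> E \<and> {g c, e y q} \<in> E \<and>
          (\<forall>d\<in>V. fst d \<noteq> i \<and> fst d \<noteq> j \<and> fst c \<noteq> fst d \<longrightarrow> {g c, g d} \<in> E)))"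
      for x y and z :: "nat \<times> nat \<times> (nat \<times> nat \<Rightarrow> nat) \<times> nat \<times> nat"
    define C where "C = {1..r} \<times> {1..r} \<times> (V \<rightarrow>\<^sub>E insert 0 K) \<times> {..<D} \<times> {..<D}"
    have finC: "finite C"
      by (simp add: C_def finK finite_PiE)
    have "card (insert 0 K) \<le> Suc k"
      using cardK finK by (simp add: card_insert_if)
    then have cardC: "card C \<le> colours"
      by (simp add: C_def colours_def card_cartesian_product card_PiE power_mono)
    have pair: "\<exists>z. z \<in> C \<and> P x y z" if xy: "x \<in> X" "y \<in> X" "x < y" for x y
    proof -
      have x: "x \<in> low W E D" and y: "y \<in> low W E D"
        using XL xy by auto
      have K: "reach W E D x \<inter> reach W E D y = K" "nb E x \<inter> K = nb E y \<inter> K"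
        using sun Z xy by auto
      obtain i j g u v where ij: "i \<in> {1..r}" "j \<in> {1..r}" "i \<noteq> j"
        and uv: "u \<in> nb E x - K" "v \<in> nb E y - K" "{u, v} \<in> E"
        and g: "inj_on g {c\<in>V. fst c \<noteq> i \<and> fst c \<noteq> j}"
          "\<forall>c\<in>V. fst c \<noteq> i \<and> fst c \<noteq> j \<longrightarrow> g c \<in> K \<and> {g c, u} \<in> E \<and> {g c, v} \<in> E \<and>
            (\<forall>d\<in>V. fst d \<noteq> i \<and> fst d \<noteq> j \<and> fst c \<noteq> fst d \<longrightarrow> {g c, g d} \<in> E)"
        using bad_pair[OF x y less_imp_neq[OF xy(3)] K(1) KL K(2) le[rule_format, OF xy(1)]
            le[rule_format, OF xy(2)] bad[OF xy(1)] bad[OF xy(2)]]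
        by (elim exE conjE)
      obtain p where p: "p < D" "e x p = u"
        using e_ex xy(1) uv(1) by blast
      obtain q where q: "q < D" "e y q = v"
        using e_ex xy(2) uv(2) by blast
      \<comment> \<open>On the parts \<open>i\<close> and \<open>j\<close>, where nothing is known
        about \<open>g\<close>, the value 0 puts the map into the finite function space used for
        \<open>C\<close>.\<close>
      define g' where "g' = (\<lambda>c\<in>V. if fst c \<noteq> i \<and> fst c \<noteq> j then g c else 0)"
      have g': "g' c = g c" if "c \<in> V" "fst c \<noteq> i \<and> fst c \<noteq> j" for c
        using that by (simp add: g'_def)
      have "inj_on g' {c\<in>V. fst c \<noteq> i \<and> fst c \<noteq> j}"
        using g(1) by (rule inj_on_cong[THEN iffD2, rotated]) (simp add: g')
      moreover have "g' \<in> V \<rightarrow>\<^sub>E insert 0 K"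
        using g(2) by (auto simp: g'_def)
      ultimately have "(i, j, g', p, q) \<in> C \<and> P x y (i, j, g', p, q)"
        using ij uv p q g(2) by (simp add: C_def P_def g')
      then show ?thesis
        by blast
    qed
    define f where "f x y = (SOME z. z \<in> C \<and> P x y z)" for x y
    have f: "f x y \<in> C \<and> P x y (f x y)" if "x \<in> X" "y \<in> X" "x < y" for x y
      unfolding f_def using pair[OF that] by (rule someI_ex)
    then have "finite C \<and> card C \<le> colours \<and> N \<le> card X \<and>
        (\<forall>x\<in>X. \<forall>y\<in>X. x < y \<longrightarrow> f x y \<in> C)"
      using finC cardC MX by (simp add: M_def)
    from N[rule_format, OF this] obtain Y z where Y: "Y \<subseteq> X" "card Y = 2 * t"
      and z: "\<forall>x\<in>Y. \<forall>y\<in>Y. x < y \<longrightarrow> f x y = z"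
      by blast
    obtain i j g p q where z_eq: "z = (i, j, g, p, q)"
      by (metis surj_pair)
    have finY: "finite Y"
      using Y(1) finX by (rule finite_subset)
    define l where "l = sorted_list_of_set Y"
    have l: "length l = 2 * t" "set l = Y" "sorted_wrt (<) l" "distinct l"
      using Y(2) finY by (auto simp: l_def)
    \<comment> \<open>Each of the first \<open>t\<close> vertices of \<open>l\<close> precedes each
      of the last \<open>t\<close>, so every pair from the two halves has the common colour.\<close>
    define A where "A m = e (l ! m) p" for m
    define B where "B m = e (l ! (t + m)) q" for m
    have lY: "l ! m \<in> Y" if "m < 2 * t" for m
      using l that by (metis nth_mem)
    have P: "P (l ! m) (l ! (t + m')) (i, j, g, p, q)" if m: "m < t" "m' < t" for m m'
    proof -
      have "l ! m < l ! (t + m')"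
        using sorted_wrt_nth_less[OF l(3)] m l(1) by simp
      moreover have "l ! m \<in> Y" "l ! (t + m') \<in> Y"
        using lY m by simp_all
      ultimately show ?thesis
        using f z z_eq Y(1) by (metis subsetD)
    qed
    have ij: "i \<noteq> j" and AB: "\<And>m m'. m < t \<Longrightarrow> m' < t \<Longrightarrow> {A m, B m'} \<in> E"
      and A: "\<And>m. m < t \<Longrightarrow> A m \<in> nb E (l ! m) - K"
      and B: "\<And>m. m < t \<Longrightarrow> B m \<in> nb E (l ! (t + m)) - K"
      and g_inj: "inj_on g {c\<in>V. fst c \<noteq> i \<and> fst c \<noteq> j}"
      using P P[of 0 0] P[of _ 0] P[of 0] t_pos by (auto simp: P_def A_def B_def)
    have g: "g c \<in> K" "m < t \<Longrightarrow> {g c, A m} \<in> E" "m < t \<Longrightarrow> {g c, B m} \<in> E"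
      "d \<in> V \<Longrightarrow> fst d \<noteq> i \<Longrightarrow> fst d \<noteq> j \<Longrightarrow> fst c \<noteq> fst d \<Longrightarrow> {g c, g d} \<in> E"
      if "c \<in> V" "fst c \<noteq> i" "fst c \<noteq> j" for c d m
      using P[of 0 0] P[of m 0] P[of 0 m] t_pos that by (auto simp: P_def A_def B_def)
    have disj: "(nb E x - K) \<inter> (nb E y - K) = {}" if "x \<in> Y" "y \<in> Y" "x \<noteq> y" for x y
    proof -
      have "reach W E D x \<inter> reach W E D y = K"
        using sun Y(1) that by (metis subsetD)
      moreover have "nb E x \<subseteq> reach W E D x" "nb E y \<subseteq> reach W E D y"
        by (auto simp: reach_def)
      ultimately show ?thesis
        by blast
    qed
    have l_neq: "l ! m \<noteq> l ! m'" if "m < 2 * t" "m' < 2 * t" "m \<noteq> m'" for m m'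
      using l that by (simp add: nth_eq_iff_index_eq)
    have A_inj: "m = m'" if "A m = A m'" "m < t" "m' < t" for m m'
      using A[of m] A[of m'] disj[of "l ! m" "l ! m'"] lY[of m] lY[of m'] l_neq[of m m'] that by auto
    have B_inj: "m = m'" if "B m = B m'" "m < t" "m' < t" for m m'
      using B[of m] B[of m'] disj[of "l ! (t + m)" "l ! (t + m')"] lY[of "t + m"] lY[of "t + m'"]
        l_neq[of "t + m" "t + m'"] that by auto
    have A_B: "A m \<noteq> B m'" if "m < t" "m' < t" for m m'
      using AB[OF that] edge[of "{A m, B m'}"] by auto
    \<comment> \<open>No part is larger than \<open>t\<close>, so \<open>t\<close> vertices on
      either side suffice for the parts \<open>i\<close> and \<open>j\<close>.\<close>
    define \<phi> where "\<phi> c = (if fst c = i then B (snd c) else if fst c = j then A (snd c) else g c)"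
      for c :: "nat \<times> nat"
    have snd_less: "snd c < t" if "c \<in> V" for c
      using that size_le[of "fst c"] by (auto simp: multipartite_verts_def)
    have "embeds r s E \<phi>"
      unfolding embeds_def
    proof (intro conjI ballI impI)
      show "inj_on \<phi> V"
      proof (rule inj_onI)
        fix c d assume c: "c \<in> V" and d: "d \<in> V" and eq: "\<phi> c = \<phi> d"
        note sn = snd_less[OF c] snd_less[OF d]
        consider "fst c = i" | "fst c = j" | "fst c \<noteq> i" "fst c \<noteq> j"
          by blast
        then show "c = d"
        proof cases
          case 1
          moreover have "fst d \<noteq> j"
            using 1 eq ij A_B[OF sn(2) sn(1)] by (auto simp: \<phi>_def)
          moreover have "fst d = i"
            using 1 eq ij B[OF sn(1)] g(1)[OF d] \<open>fst d \<noteq> j\<close> by (auto simp: \<phi>_def split: if_splits)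
          ultimately show ?thesis
            using eq B_inj[OF _ sn] by (auto simp: \<phi>_def prod_eq_iff)
        next
          case 2
          moreover have "fst d \<noteq> i"
            using 2 eq ij A_B[OF sn(1) sn(2)] by (auto simp: \<phi>_def)
          moreover have "fst d = j"
            using 2 eq ij A[OF sn(1)] g(1)[OF d] \<open>fst d \<noteq> i\<close> by (auto simp: \<phi>_def split: if_splits)
          ultimately show ?thesis
            using eq A_inj[OF _ sn] by (auto simp: \<phi>_def prod_eq_iff)
        next
          case 3
          moreover have "fst d \<noteq> i"
            using 3 eq ij B[OF sn(2)] g(1)[OF c] by (auto simp: \<phi>_def)
          moreover have "fst d \<noteq> j"
            using 3 eq ij A[OF sn(2)] g(1)[OF c] \<open>fst d \<noteq> i\<close> by (auto simp: \<phi>_def)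
          ultimately show ?thesis
            using eq c d inj_onD[OF g_inj, of c d] by (simp add: \<phi>_def)
        qed
      qed
      fix c d assume c: "c \<in> V" and d: "d \<in> V" and ne: "fst c \<noteq> fst d"
      note sn = snd_less[OF c] snd_less[OF d]
      consider "fst c = i" "fst d = j" | "fst c = i" "fst d \<noteq> j" | "fst c = j" "fst d = i"
        | "fst c = j" "fst d \<noteq> i" | "fst c \<noteq> i" "fst c \<noteq> j"
        by blast
      then show "{\<phi> c, \<phi> d} \<in> E"
      proof cases
        case 1
        then show ?thesis
          using AB[OF sn(2,1)] ij by (simp add: \<phi>_def insert_commute)
      next
        case 2
        then show ?thesis
          using g(3)[OF d _ _ sn(1)] ne by (simp add: \<phi>_def insert_commute)
      next
        case 3
        then show ?thesis
          using AB[OF sn(1,2)] ij by (simp add: \<phi>_def)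
      next
        case 4
        then show ?thesis
          using g(2)[OF d _ _ sn(1)] ne ij by (simp add: \<phi>_def insert_commute)
      next
        case 5
        then show ?thesis
          using g(2)[OF c _ _ sn(2)] g(3)[OF c _ _ sn(2)] g(4)[OF c _ _ d] ne by (simp add: \<phi>_def)
      qed
    qed
    then show False
      using no_copy by blast
  qed
qed

text \<open>In a sunflower of the sets \<open>reach\<close> with constant trace of
  \<open>nb E\<close> on the kernel, two vertices are found whose high neighbours all lie in the
  kernel; there the neighbourhoods agree.\<close>

lemma twins:
  "\<exists>M. \<forall>W (E :: nat set set) Y. saturated_edge_set r s W E \<and> Y \<subseteq> low W E D \<and>
     (\<forall>x\<in>Y. weight W E D x \<le> k2) \<and> M \<le> card Y \<longrightarrow>
     (\<exists>x\<in>Y. \<exists>y\<in>Y. x \<noteq> y \<and> weight W E D x = k2 \<and>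
        nb E x - low W E D = nb E y - low W E D)"
proof -
  define k where "k = Suc (D + D * D)"
  obtain M where M: "\<forall>W (E :: nat set set) X K Z. saturated_edge_set r s W E \<and> X \<subseteq> low W E D \<and>
     (\<forall>x\<in>X. weight W E D x \<le> k2) \<and> finite K \<and> card K \<le> k \<and>
     (\<forall>x\<in>X. \<forall>y\<in>X. x \<noteq> y \<longrightarrow> reach W E D x \<inter> reach W E D y = K) \<and>
     (\<forall>x\<in>X. nb E x \<inter> K = Z) \<and> M \<le> card X \<longrightarrow>
     (\<exists>x\<in>X. weight W E D x = k2 \<and> nb E x - low W E D \<subseteq> K)"
    using kernel_contains_high_nb[where D = D and k = k] by (elim exE)
  obtain N where N: "\<forall>(Y::nat set) (U::nat \<Rightarrow> nat set) W. N \<le> card Y \<and>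
     (\<forall>x\<in>Y. finite (U x) \<and> card (U x) \<le> k) \<longrightarrow>
     (\<exists>X K Z. X \<subseteq> Y \<and> card X = Suc M \<and> finite K \<and> card K \<le> k \<and>
        (\<forall>x\<in>X. \<forall>y\<in>X. x \<noteq> y \<longrightarrow> U x \<inter> U y = K) \<and> (\<forall>x\<in>X. W x \<inter> K = Z))"
    using delta_system_trace[where k = k and m = "Suc M"] by (elim exE)
  show ?thesis
  proof (rule exI[of _ N], intro allI impI, elim conjE)
    fix W and E :: "nat set set" and Y
    assume sat: "saturated_edge_set r s W E" and YL: "Y \<subseteq> low W E D"
      and le: "\<forall>x\<in>Y. weight W E D x \<le> k2" and NY: "N \<le> card Y"
    interpret saturated_edge_set r s W E
      by (fact sat)
    have "\<forall>x\<in>Y. finite (reach W E D x) \<and> card (reach W E D x) \<le> k"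
      using YL card_reach finite_reach by (auto simp: k_def)
    from N[rule_format, OF conjI, OF NY this, of "nb E"] obtain X K Z where
      X: "X \<subseteq> Y" "card X = Suc M" and K: "finite K" "card K \<le> k"
      and sun: "\<forall>x\<in>X. \<forall>y\<in>X. x \<noteq> y \<longrightarrow> reach W E D x \<inter> reach W E D y = K"
      and Z: "\<forall>x\<in>X. nb E x \<inter> K = Z"
      by (elim exE conjE)
    have find: "\<exists>x\<in>X'. weight W E D x = k2 \<and> nb E x - low W E D \<subseteq> K"
      if "X' \<subseteq> X" "M \<le> card X'" for X'
    proof (rule M[rule_format], intro conjI)
      show "saturated_edge_set r s W E" "finite K" "card K \<le> k" "M \<le> card X'"
        by fact+
      show "X' \<subseteq> low W E D" "\<forall>x\<in>X'. weight W E D x \<le> k2"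
        using that X YL le by blast+
      show "\<forall>x\<in>X'. \<forall>y\<in>X'. x \<noteq> y \<longrightarrow> reach W E D x \<inter> reach W E D y = K"
        "\<forall>x\<in>X'. nb E x \<inter> K = Z"
        using that sun Z by blast+
    qed
    obtain x where x: "x \<in> X" "weight W E D x = k2" "nb E x - low W E D \<subseteq> K"
      using find[of X] X by auto
    \<comment> \<open>The sunflower has \<open>Suc M\<close> members, so \<open>M\<close> remain
      after removing \<open>x\<close>.\<close>
    obtain y where y: "y \<in> X" "y \<noteq> x" "nb E y - low W E D \<subseteq> K"
      using find[of "X - {x}"] X x(1) by auto
    have "nb E x \<inter> K = nb E y \<inter> K"
      using Z x(1) y(1) by simp
    then have "nb E x - low W E D = nb E y - low W E D"
      using x(3) y(3) by blast
    moreover have "x \<in> Y" "y \<in> Y"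
      using x(1) y(1) X(1) by auto
    ultimately show "\<exists>x\<in>Y. \<exists>y\<in>Y. x \<noteq> y \<and> weight W E D x = k2 \<and>
        nb E x - low W E D = nb E y - low W E D"
      using x(2) y(2) by (intro bexI[of _ x] bexI[of _ y] conjI) auto
  qed
qed

text \<open>Discharging: every low vertex of weight above \<open>k2\<close> passes \<open>1/(k2 + 2)\<close> of each of its edges
  to a high vertex outside the bounded set \<open>A\<close> on to that vertex.\<close>

lemma saturated_edges_lower:
  "\<exists>C. \<forall>W (E :: nat set set). saturated_edge_set r s W E \<longrightarrow> k2 * card W \<le> 2 * card E + C"
proof -
  \<comment> \<open>Inequalities are multiplied by \<open>q\<close> to avoid fractions. This value
    makes \<open>(q - 1) * (k2 + 1)\<close> at least \<open>q * k2\<close>; with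
    \<open>D = q * q\<close>, a high vertex has enough edges to receive its share from them.\<close>
  define q where "q = k2 + 2"
  define D where "D = q * q"
  have "0 < q"
    by (simp add: q_def)
  obtain M where M: "\<forall>W (E :: nat set set) Y. saturated_edge_set r s W E \<and> Y \<subseteq> low W E D \<and>
     (\<forall>x\<in>Y. weight W E D x \<le> k2) \<and> M \<le> card Y \<longrightarrow>
     (\<exists>x\<in>Y. \<exists>y\<in>Y. x \<noteq> y \<and> weight W E D x = k2 \<and>
        nb E x - low W E D = nb E y - low W E D)"
    using twins[where D = D] by (elim exE)
  show ?thesis
  \<comment> \<open>At most \<open>M * D\<close> high vertices (the set \<open>A\<close>) and at
    most \<open>M\<close> low ones (the set \<open>B\<close>) fall short, each by at most
    \<open>k2\<close>.\<close>
  proof (rule exI[of _ "k2 * (M * D + M)"], intro allI impI)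
    fix W and E :: "nat set set"
    assume sat: "saturated_edge_set r s W E"
    interpret saturated_edge_set r s W E
      by (fact sat)
    define L where "L = low W E D"
    define H where "H = W - L"
    define w where "w = weight W E D"
    define T where "T = {x\<in>L. w x \<le> k2}"
    define B where "B = {x\<in>T. w x < k2}"
    define A where "A = (\<Union>x\<in>T. nb E x - L)"
    define G where "G = H - A"
    have LW: "L \<subseteq> W" and finL: "finite L" and finH: "finite H"
      using low_subset finite_low finite_W by (auto simp: L_def H_def)
    have finT: "finite T"
      using finL by (simp add: T_def)
    have nbH: "nb E x - L = nb E x \<inter> H" for x
      using nb_subset[of x] by (auto simp: H_def)
    \<comment> \<open>This is \<open>twins\<close> in contrapositive form. It is used for
      \<open>B\<close>, where no weight equals \<open>k2\<close>, and for a set of representatives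
      of the high neighbourhoods.\<close>
    have small: "card Y < M" if "Y \<subseteq> T"
      "\<And>x y. x \<in> Y \<Longrightarrow> y \<in> Y \<Longrightarrow> x \<noteq> y \<Longrightarrow> w x = k2 \<Longrightarrow> nb E x - L \<noteq> nb E y - L" for Y
    proof (rule ccontr)
      assume "\<not> card Y < M"
      moreover have "Y \<subseteq> low W E D" "\<forall>x\<in>Y. weight W E D x \<le> k2"
        using that(1) by (auto simp: T_def L_def w_def)
      ultimately have "\<exists>x\<in>Y. \<exists>y\<in>Y. x \<noteq> y \<and> weight W E D x = k2 \<and>
          nb E x - low W E D = nb E y - low W E D"
        using M sat by (metis not_less)
      then show False
        using that(2) by (auto simp: w_def L_def)
    qed
    have cardB: "card B \<le> M"
      using small[of B] by (fastforce simp: B_def)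
    have cardA: "card A \<le> M * D"
    proof -
      \<comment> \<open>One vertex is chosen for each high neighbourhood occurring in
        \<open>T\<close>, so the union \<open>A\<close> does not change.\<close>
      obtain Y where Y: "Y \<subseteq> T" "inj_on (\<lambda>x. nb E x - L) Y"
        "(\<lambda>x. nb E x - L) ` T = (\<lambda>x. nb E x - L) ` Y"
        using subset_image_inj[of "(\<lambda>x. nb E x - L) ` T" "\<lambda>x. nb E x - L" T] by auto
      have "card Y < M"
        using small[of Y] Y(1,2) by (auto dest: inj_onD)
      have "finite Y"
        using Y(1) finT by (rule finite_subset)
      have "A = (\<Union>x\<in>Y. nb E x - L)"
        unfolding A_def using Y(3) by simp
      then have "card A \<le> (\<Sum>x\<in>Y. card (nb E x - L))"
        using card_UN_le[OF \<open>finite Y\<close>, of "\<lambda>x. nb E x - L"] by (simp only:)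
      also have "\<dots> \<le> (\<Sum>x\<in>Y. D)"
      proof (rule sum_mono)
        fix x assume "x \<in> Y"
        then have "card (nb E x) < D"
          using Y(1) by (auto simp: T_def L_def low_def)
        moreover have "card (nb E x - L) \<le> card (nb E x)"
          by (intro card_mono) auto
        ultimately show "card (nb E x - L) \<le> D"
          by simp
      qed
      also have "\<dots> \<le> M * D"
        using \<open>card Y < M\<close> by (simp add: mult_right_mono)
      finally show ?thesis .
    qed
    have w_eq: "w x = 2 * card (nb E x \<inter> H) + card (nb E x \<inter> L)" for x
      by (simp add: w_def weight_def nbH[unfolded L_def] L_def)
    have deg: "card (nb E x) = card (nb E x \<inter> H) + card (nb E x \<inter> L)" for x
      using card_nb_split[of x L] by (simp add: nbH)
    have "2 * card E = (\<Sum>x\<in>L. card (nb E x)) + (\<Sum>x\<in>H. card (nb E x))"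
      unfolding sum_degrees[symmetric] H_def using sum.subset_diff[OF LW finite_W] by (simp add: add.commute)
    \<comment> \<open>An edge between \<open>L\<close> and \<open>H\<close> is counted at both ends;
      its count at the high end is moved to the low end, where \<open>w\<close> counts it
      twice.\<close>
    also have "\<dots> = (\<Sum>x\<in>L. w x) + (\<Sum>x\<in>H. card (nb E x \<inter> H))"
      using sum_nb_swap[of L H] LW by (simp add: deg w_eq sum.distrib H_def mult_2)
    finally have E_eq: "2 * card E = (\<Sum>x\<in>L. w x) + (\<Sum>x\<in>H. card (nb E x \<inter> H))" .
    have GW: "G \<subseteq> W"
      by (auto simp: G_def H_def)
    \<comment> \<open>A vertex of \<open>T\<close> has no neighbour in \<open>G\<close> and passes
      nothing on. Any other low vertex passes on at most \<open>w x\<close> in this scaling and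
      keeps \<open>(q - 1) * w x\<close>, which suffices because \<open>w x\<close> is at least
      \<open>k2 + 1\<close>.\<close>
    have low_vertex: "q * k2 + 2 * card (nb E x \<inter> G) \<le> q * w x + (if x \<in> B then q * k2 else 0)"
      if x: "x \<in> L" for x
    proof (cases "x \<in> T")
      case True
      then have "nb E x \<inter> G = {}"
        by (auto simp: G_def A_def H_def)
      moreover have "x \<notin> B \<Longrightarrow> w x = k2"
        using True by (auto simp: B_def T_def)
      ultimately show ?thesis
        by auto
    next
      case False
      then have w_ge: "k2 + 1 \<le> w x"
        using x by (simp add: T_def)
      have "card (nb E x \<inter> G) \<le> card (nb E x \<inter> H)"
        by (intro card_mono) (auto simp: G_def)
      then have "2 * card (nb E x \<inter> G) \<le> w x"
        by (simp add: w_eq)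
      moreover have "(k2 + 1) * (k2 + 1) \<le> (k2 + 1) * w x"
        using w_ge by (rule mult_left_mono) simp
      ultimately show ?thesis
        by (simp add: q_def algebra_simps)
    qed
    \<comment> \<open>A vertex of \<open>G\<close> has at least \<open>q * q\<close> neighbours, and
      each contributes at least 2 on the right because \<open>q\<close> is at least 2.\<close>
    have high_vertex: "q * k2 \<le> q * card (nb E x \<inter> H) +
        ((if x \<in> A then q * k2 else 0) + (if x \<in> G then 2 * card (nb E x \<inter> L) else 0))"
      if x: "x \<in> H" for x
    proof (cases "x \<in> A")
      case False
      then have "x \<in> G"
        using x by (simp add: G_def)
      have "D \<le> card (nb E x)"
        using x by (auto simp: H_def L_def low_def)
      then have "q * q \<le> card (nb E x \<inter> H) + card (nb E x \<inter> L)"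
        by (simp add: D_def deg)
      moreover have "q * k2 \<le> q * q"
        by (simp add: q_def)
      moreover have "2 * card (nb E x \<inter> H) \<le> q * card (nb E x \<inter> H)"
        unfolding q_def by (intro mult_right_mono) auto
      ultimately have "q * k2 \<le> q * card (nb E x \<inter> H) + 2 * card (nb E x \<inter> L)"
        by linarith
      then show ?thesis
        using \<open>x \<in> G\<close> False by simp
    qed simp
    have "(\<Sum>x\<in>L. q * k2 + 2 * card (nb E x \<inter> G)) \<le>
        (\<Sum>x\<in>L. q * w x + (if x \<in> B then q * k2 else 0))"
      using low_vertex by (rule sum_mono)
    moreover have "(\<Sum>x\<in>L. if x \<in> B then q * k2 else 0) = card B * (q * k2)"
    proof -
      have "L \<inter> B = B"
        by (auto simp: B_def T_def)
      then show ?thesis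
        using finL by (simp add: sum.If_cases)
    qed
    ultimately have sumL: "card L * (q * k2) + 2 * (\<Sum>x\<in>L. card (nb E x \<inter> G)) \<le>
        q * (\<Sum>x\<in>L. w x) + card B * (q * k2)"
      by (simp add: sum.distrib sum_distrib_left)
    have "(\<Sum>x\<in>H. q * k2) \<le> (\<Sum>x\<in>H. q * card (nb E x \<inter> H) +
        ((if x \<in> A then q * k2 else 0) + (if x \<in> G then 2 * card (nb E x \<inter> L) else 0)))"
      using high_vertex by (rule sum_mono)
    moreover have "(\<Sum>x\<in>H. if x \<in> A then q * k2 else 0) = card A * (q * k2)"
    proof -
      have "H \<inter> A = A"
        by (auto simp: A_def nbH)
      then show ?thesis
        using finH by (simp add: sum.If_cases)
    qed
    moreover have "(\<Sum>x\<in>H. if x \<in> G then 2 * card (nb E x \<inter> L) else 0) =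
        2 * (\<Sum>x\<in>G. card (nb E x \<inter> L))"
    proof -
      have "H \<inter> G = G"
        by (auto simp: G_def)
      then show ?thesis
        using finH by (simp add: sum.If_cases sum_distrib_left)
    qed
    ultimately have sumH: "card H * (q * k2) \<le> q * (\<Sum>x\<in>H. card (nb E x \<inter> H)) +
        card A * (q * k2) + 2 * (\<Sum>x\<in>G. card (nb E x \<inter> L))"
      by (simp add: sum.distrib sum_distrib_left)
    have "card W = card L + card H"
      using card_Diff_subset[OF finL LW] card_mono[OF finite_W LW] by (simp add: H_def)
    then have "q * (k2 * card W) = card L * (q * k2) + card H * (q * k2)"
      by (simp add: algebra_simps)
    also have "\<dots> \<le> q * (2 * card E) + (card A + card B) * (q * k2)"
      using sumL sumH sum_nb_swap[OF LW GW] unfolding E_eq by (simp add: algebra_simps)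
    also have "\<dots> \<le> q * (2 * card E) + (M * D + M) * (q * k2)"
      using cardA cardB by (intro add_mono mult_right_mono) auto
    also have "\<dots> = q * (2 * card E + k2 * (M * D + M))"
      by (simp add: algebra_simps)
    finally show "k2 * card W \<le> 2 * card E + k2 * (M * D + M)"
      using \<open>0 < q\<close> by (simp only: nat_mult_le_cancel1)
  qed
qed

end

section \<open>The upper bound\<close>

lemma embeds_mono: "embeds r s E \<phi> \<Longrightarrow> E \<subseteq> E' \<Longrightarrow> embeds r s E' \<phi>"
  by (auto simp: embeds_def)

text \<open>Only opposite vertices are required to differ; adjacent ones do so automatically when
  all edges have two elements.\<close>

definition c4_free :: "'a set set \<Rightarrow> bool" where
  "c4_free R \<longleftrightarrow> (\<forall>a b c d. a \<noteq> c \<longrightarrow> b \<noteq> d \<longrightarrow> {a, b} \<in> R \<longrightarrow> {b, c} \<in> R \<longrightarrow> {c, d} \<in> R \<longrightarrow> {d, a} \<notin> R)"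

text \<open>A new 4-cycle contains the new edge, and its other three sides would form a walk of
  three old edges from \<open>x\<close> to \<open>y\<close>.\<close>

lemma c4_free_insert:
  assumes "c4_free R" and edge: "\<And>e. e \<in> R \<Longrightarrow> card e = 2" and "x \<noteq> y"
    and far: "\<And>u v. {x, u} \<in> R \<Longrightarrow> {u, v} \<in> R \<Longrightarrow> {v, y} \<notin> R"
  shows "c4_free (insert {x, y} R)"
  unfolding c4_free_def
proof (intro allI impI notI)
  fix a b c d
  assume ne: "a \<noteq> c" "b \<noteq> d" and cycle: "{a, b} \<in> insert {x, y} R" "{b, c} \<in> insert {x, y} R"
    "{c, d} \<in> insert {x, y} R" "{d, a} \<in> insert {x, y} R"
  have no_path: False if "{p, q} = {x, y}" "{q, u} \<in> R" "{u, v} \<in> R" "{v, p} \<in> R" for p q u v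
  proof -
    from that(1) consider "p = x" "q = y" | "p = y" "q = x"
      by (auto simp: doubleton_eq_iff)
    then show False
      using far[of v u] far[of u v] that(2-4) by cases (auto simp: insert_commute)
  qed
  have "card e = 2" if "e \<in> insert {x, y} R" for e
    using that edge \<open>x \<noteq> y\<close> by auto
  then have "card {a, b} = 2" "card {b, c} = 2" "card {c, d} = 2" "card {d, a} = 2"
    using cycle by blast+
  then have "a \<noteq> b" "b \<noteq> c" "c \<noteq> d" "d \<noteq> a"
    by auto
  \<comment> \<open>The four sides are pairwise distinct, so at most one of them is the new
    edge.\<close>
  then have "{a, b} \<noteq> {b, c}" "{b, c} \<noteq> {c, d}" "{c, d} \<noteq> {d, a}" "{d, a} \<noteq> {a, b}"
    "{a, b} \<noteq> {c, d}" "{b, c} \<noteq> {d, a}"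
    using ne by (auto simp: doubleton_eq_iff)
  then consider "{a, b} \<in> R" "{b, c} \<in> R" "{c, d} \<in> R" "{d, a} \<in> R"
    | "{a, b} = {x, y}" "{b, c} \<in> R" "{c, d} \<in> R" "{d, a} \<in> R"
    | "{b, c} = {x, y}" "{c, d} \<in> R" "{d, a} \<in> R" "{a, b} \<in> R"
    | "{c, d} = {x, y}" "{d, a} \<in> R" "{a, b} \<in> R" "{b, c} \<in> R"
    | "{d, a} = {x, y}" "{a, b} \<in> R" "{b, c} \<in> R" "{c, d} \<in> R"
    using cycle by (metis insert_iff)
  then show False
  proof cases
    case 1
    then show ?thesis
      using assms(1) ne unfolding c4_free_def by blast
  qed (erule (3) no_path)+
qed

definition ball3 :: "'a set set \<Rightarrow> 'a \<Rightarrow> 'a set" where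
  "ball3 R x = (\<Union>u\<in>insert x (nb R x). \<Union>v\<in>insert u (nb R u). insert v (nb R v))"

context edge_set
begin

lemma edge_set_insert: "x \<in> W \<Longrightarrow> y \<in> W \<Longrightarrow> x \<noteq> y \<Longrightarrow> edge_set W (insert {x, y} E)"
  using finite_W edge by unfold_locales auto

lemma card_ball3:
  assumes "\<And>x. card (nb E x) \<le> d"
  shows "card (ball3 E x) \<le> Suc d * (Suc d * Suc d)"
proof -
  have one: "card (insert x (nb E x)) \<le> Suc d" for x
    using assms[of x] by (simp add: card_insert_if)
  have step: "card (\<Union>u\<in>insert x (nb E x). A u) \<le> Suc d * k" if "\<And>u. card (A u) \<le> k"
    for x k and A :: "'a \<Rightarrow> 'a set"
  proof -
    have "card (\<Union>u\<in>insert x (nb E x). A u) \<le> (\<Sum>u\<in>insert x (nb E x). card (A u))"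
      by (rule card_UN_le) simp
    also have "\<dots> \<le> of_nat (card (insert x (nb E x))) * k"
      using that by (intro sum_bounded_above) auto
    also have "\<dots> \<le> Suc d * k"
      using one[of x] by (simp only: of_nat_id mult_right_mono)
    finally show ?thesis .
  qed
  show ?thesis
    unfolding ball3_def by (intro step one)
qed

end

text \<open>Maximality: joining two vertices of degree less than \<open>d\<close> must create a 4-cycle, hence they are
  at distance at most 3.\<close>

lemma c4_free_almost_regular:
  fixes P :: "nat set"
  assumes "finite P"
  obtains R where "edge_set P R" "c4_free R" "\<And>x. card (nb R x) \<le> d"
    "card {x\<in>P. card (nb R x) < d} \<le> Suc d * (Suc d * Suc d)"
proof -
  define good where "good R \<longleftrightarrow> edge_set P R \<and> c4_free R \<and> (\<forall>x. card (nb R x) \<le> d)" for R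
  have "{R. good R} \<subseteq> Pow (Pow P)"
    by (auto simp: good_def dest: edge_set.edge)
  then have fin: "finite {R. good R}"
    by (rule finite_subset) (simp add: assms)
  have "good {}"
    using assms by (auto simp: good_def c4_free_def nb_def edge_set_def)
  then obtain R where R: "good R" and maxR: "\<And>R'. good R' \<Longrightarrow> R \<subseteq> R' \<Longrightarrow> R' = R"
    using finite_has_maximal[OF fin] by (metis empty_iff mem_Collect_eq)
  interpret edge_set P R
    using R by (simp add: good_def)
  have R': "c4_free R" "\<And>x. card (nb R x) \<le> d"
    using R by (auto simp: good_def)
  define F where "F = {x\<in>P. card (nb R x) < d}"
  have "y \<in> ball3 R x" if xy: "x \<in> F" "y \<in> F" for x y
  proof (rule ccontr)
    assume y: "y \<notin> ball3 R x"
    have "x \<noteq> y" "{x, y} \<notin> R"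
      using y by (auto simp: ball3_def nb_def)
    have "good (insert {x, y} R)"
      unfolding good_def
    proof (intro conjI allI)
      show "edge_set P (insert {x, y} R)"
        using xy \<open>x \<noteq> y\<close> by (intro edge_set_insert) (auto simp: F_def)
      show "c4_free (insert {x, y} R)"
      proof (rule c4_free_insert)
        fix u v assume "{x, u} \<in> R" "{u, v} \<in> R"
        then show "{v, y} \<notin> R"
          using y by (auto simp: ball3_def nb_def)
      qed (use R'(1) edge \<open>x \<noteq> y\<close> in auto)
      fix z
      have "nb (insert {x, y} R) z = (if z = x then insert y (nb R x) else
          if z = y then insert x (nb R y) else nb R z)"
        using \<open>x \<noteq> y\<close> by (auto simp: nb_def doubleton_eq_iff)
      then show "card (nb (insert {x, y} R) z) \<le> d"
        using R'(2) xy by (auto simp: F_def card_insert_if)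
    qed
    then show False
      using maxR[of "insert {x, y} R"] \<open>{x, y} \<notin> R\<close> by blast
  qed
  then have "card F \<le> Suc d * (Suc d * Suc d)"
  proof (cases "F = {}")
    case False
    then obtain x where "x \<in> F"
      by blast
    with \<open>\<And>x y. x \<in> F \<Longrightarrow> y \<in> F \<Longrightarrow> y \<in> ball3 R x\<close> have "F \<subseteq> ball3 R x"
      by blast
    then have "card F \<le> card (ball3 R x)"
      by (intro card_mono) (auto simp: ball3_def)
    then show ?thesis
      using card_ball3[OF R'(2)] by (rule order_trans)
  qed simp
  then show ?thesis
    using that[OF _ R'] R by (simp add: good_def F_def)
qed

section \<open>Saturated extensions and the join with \<open>S - 1\<close> vertices\<close>

context part_sizes
begin

lemma other_part:
  assumes "a \<in> V"
  obtains b where "b \<in> V" "fst a \<noteq> fst b"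
proof -
  have "\<exists>i\<in>{1..r}. i \<noteq> fst a"
    using two_parts by (intro bexI[of _ "if fst a = 1 then 2 else 1"]) auto
  then obtain i where "i \<in> {1..r}" "i \<noteq> fst a"
    by blast
  then show ?thesis
    using size_pos[of i] by (intro that[of "(i, 0)"]) (auto simp: multipartite_verts_def)
qed

lemma not_embeds_empty: "\<not> embeds r s {} \<phi>"
proof -
  have "(1, 0) \<in> V"
    using size_pos[of 1] two_parts by (simp add: multipartite_verts_def)
  then show ?thesis
    using other_part[of "(1, 0)"] unfolding embeds_def by blast
qed

text \<open>A maximal copy-free edge set above \<open>E0\<close> is saturated. Thus the construction
  for the upper bound need not itself be saturated, provided that only boundedly many edges can be
  added to it.\<close>

lemma saturated_extension:
  assumes E0: "edge_set W E0" and no_copy: "\<And>\<phi>. \<not> embeds r s E0 \<phi>"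
  obtains E where "E0 \<subseteq> E" "saturated_edge_set r s W E"
proof -
  define good where "good E \<longleftrightarrow> edge_set W E \<and> (\<forall>\<phi>. \<not> embeds r s E \<phi>)" for E
  have "{E. good E} \<subseteq> Pow (Pow W)"
    by (auto simp: good_def dest: edge_set.edge)
  then have fin: "finite {E. good E}"
    by (rule finite_subset) (simp add: edge_set.finite_W[OF E0])
  have "E0 \<in> {E. good E}"
    using assms by (simp add: good_def)
  from finite_has_maximal2[OF fin this] obtain E where "E \<in> {E. good E}" "E0 \<subseteq> E"
    "\<forall>E'\<in>{E. good E}. E \<subseteq> E' \<longrightarrow> E = E'"
    by (elim bexE conjE)
  then have E: "good E" "E0 \<subseteq> E" and maxE: "\<And>E'. good E' \<Longrightarrow> E \<subseteq> E' \<Longrightarrow> E = E'"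
    by simp_all
  interpret edge_set W E
    using E by (simp add: good_def)
  have "saturated_edge_set r s W E"
  proof unfold_locales
    show "\<not> embeds r s E \<phi>" for \<phi>
      using E(1) by (simp add: good_def)
    fix x y assume xy: "x \<in> W" "y \<in> W" "x \<noteq> y" "{x, y} \<notin> E"
    then have "\<not> good (insert {x, y} E)"
      using maxE by blast
    then show "\<exists>\<phi>. embeds r s (insert {x, y} E) \<phi>"
      using edge_set_insert[OF xy(1-3)] by (simp add: good_def)
  qed
  with E(2) show ?thesis
    by (rule that)
qed

text \<open>Here \<open>R\<close> is meant to be a graph on the vertices \<open>{S - 1..<n}\<close>.\<close>

definition join_edges :: "nat \<Rightarrow> nat set set \<Rightarrow> nat set set" where
  "join_edges n R = R \<union> {{a, b} | a b. a < S - 1 \<and> b < n \<and> a \<noteq> b}"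

lemma join_edges_left:
  assumes "a < S - 1" "b < n" "a \<noteq> b"
  shows "{a, b} \<in> join_edges n R" "{b, a} \<in> join_edges n R"
proof -
  show "{a, b} \<in> join_edges n R"
    using assms unfolding join_edges_def by blast
  then show "{b, a} \<in> join_edges n R"
    by (simp add: insert_commute)
qed

text \<open>The joined vertices absorb at most \<open>S - 1\<close> vertices of a copy, so a set
  \<open>T\<close> of more than \<open>t\<close> lies in \<open>R\<close> and meets at least two
  parts. A vertex alone in its part within \<open>T\<close> would have degree at least
  \<open>t\<close> in \<open>R\<close>. So two parts meet \<open>T\<close> in two vertices each,
  which gives a 4-cycle.\<close>

lemma join_edges_no_copy:
  assumes R: "edge_set {S - 1..<n} R" "c4_free R" "\<And>x. card (nb R x) \<le> t - 1"
  shows "\<not> embeds r s (join_edges n R) \<phi>"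
proof
  assume \<phi>: "embeds r s (join_edges n R) \<phi>"
  interpret edge_set "{S - 1..<n}" R
    by (fact R(1))
  have inj: "inj_on \<phi> V"
    using \<phi> by (simp add: embeds_def)
  define T where "T = {c\<in>V. S - 1 \<le> \<phi> c}"
  have TV: "T \<subseteq> V" and finT: "finite T"
    by (auto simp: T_def)
  have edge_R: "{\<phi> c, \<phi> d} \<in> R" if "c \<in> T" "d \<in> T" "fst c \<noteq> fst d" for c d
  proof -
    have "{\<phi> c, \<phi> d} \<in> join_edges n R" "S - 1 \<le> \<phi> c" "S - 1 \<le> \<phi> d"
      using \<phi> that by (auto simp: embeds_def T_def)
    then show ?thesis
      by (auto simp: join_edges_def doubleton_eq_iff)
  qed
  have "card (V - T) \<le> card {..<S - 1}"
    using inj by (intro card_inj_on_le[of \<phi>]) (auto simp: T_def intro: inj_on_subset)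
  then have "t + 1 \<le> card T"
    using card_V S_pos finT card_Diff_subset[OF finT TV] card_mono[OF finite_V TV] by simp
  then have cardT: "t < card T"
    by simp
  have two: "\<exists>b\<in>T. fst b = fst a \<and> b \<noteq> a" if a: "a \<in> T" for a
  proof (rule ccontr)
    assume "\<not> ?thesis"
    then have "\<phi> ` (T - {a}) \<subseteq> nb R (\<phi> a)"
      using edge_R[OF a] by (auto simp: nb_def)
    then have "card (\<phi> ` (T - {a})) \<le> card (nb R (\<phi> a))"
      by (rule card_mono[OF finite_nb])
    also have "\<dots> \<le> t - 1"
      by (rule R(3))
    finally have "card (\<phi> ` (T - {a})) \<le> t - 1" .
    moreover have "card (\<phi> ` (T - {a})) = card T - 1"
      using inj TV a finT by (subst card_image) (auto intro: inj_on_subset)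
    ultimately show False
      using cardT t_pos by simp
  qed
  have "T \<noteq> {}"
    using cardT by force
  then obtain a where a: "a \<in> T"
    by blast
  have "\<not> T \<subseteq> {c\<in>V. fst c = fst a}"
  proof
    assume "T \<subseteq> {c\<in>V. fst c = fst a}"
    then have "card T \<le> card {c\<in>V. fst c = fst a}"
      by (rule card_mono[rotated]) simp
    then show False
      using card_part[of a] a TV cardT by auto
  qed
  then obtain b where b: "b \<in> T" "fst b \<noteq> fst a"
    using TV by blast
  obtain a' where a': "a' \<in> T" "fst a' = fst a" "a' \<noteq> a"
    using two[OF a] by blast
  obtain b' where b': "b' \<in> T" "fst b' = fst b" "b' \<noteq> b"
    using two[OF b(1)] by blast
  have "\<phi> a \<noteq> \<phi> a'" "\<phi> b \<noteq> \<phi> b'"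
    using inj TV a a' b b' by (auto dest: inj_onD)
  moreover have "{\<phi> a, \<phi> b} \<in> R" "{\<phi> b, \<phi> a'} \<in> R" "{\<phi> a', \<phi> b'} \<in> R" "{\<phi> b', \<phi> a} \<in> R"
    using a a' b b' by (auto intro!: edge_R)
  ultimately show False
    using R(2) unfolding c4_free_def by blast
qed

text \<open>The \<open>t - 1\<close> neighbours of \<open>u\<close> together with \<open>v\<close>
  form the last part; \<open>u\<close> and the \<open>S - 1\<close> joined vertices are pairwise
  adjacent and fill all other parts.\<close>

lemma join_edges_new_copy:
  assumes R: "edge_set {S - 1..<n} R" and u: "u \<in> {S - 1..<n}" "card (nb R u) = t - 1"
    and v: "v \<in> {S - 1..<n}" "v \<noteq> u" "{u, v} \<notin> R"
  shows "\<exists>\<phi>. embeds r s (insert {u, v} (join_edges n R)) \<phi>"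
proof -
  interpret edge_set "{S - 1..<n}" R
    by (fact R)
  define L where "L = {c\<in>V. fst c = r}"
  have "L = {r} \<times> {..<t}"
    using two_parts by (auto simp: L_def multipartite_verts_def)
  then have cardL: "card L = t"
    by (simp add: card_cartesian_product)
  have LV: "L \<subseteq> V" and finL: "finite L"
    by (auto simp: L_def)
  have "v \<notin> nb R u"
    using v(3) by (simp add: nb_def)
  then have "card (insert v (nb R u)) = t"
    using u(2) t_pos by simp
  then obtain f where f: "bij_betw f L (insert v (nb R u))"
    using finite_same_card_bij[OF finL, of "insert v (nb R u)"] cardL by auto
  have "card (V - L) = S"
    using card_V cardL card_Diff_subset[OF finL LV] by simp
  moreover have "card (insert u {..<S - 1}) = S"
    using u(1) S_pos by simp
  ultimately obtain g where g: "bij_betw g (V - L) (insert u {..<S - 1})"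
    using finite_same_card_bij[of "V - L" "insert u {..<S - 1}"] by auto
  define \<phi> where "\<phi> c = (if c \<in> L then f c else g c)" for c
  have \<phi>L: "\<phi> c = v \<or> \<phi> c \<in> nb R u" if "c \<in> L" for c
    using bij_betw_apply[OF f that] that by (auto simp: \<phi>_def)
  have \<phi>V: "\<phi> c = u \<or> \<phi> c < S - 1" if "c \<in> V - L" for c
    using bij_betw_apply[OF g that] that by (auto simp: \<phi>_def)
  have P: "S - 1 \<le> \<phi> c" "\<phi> c < n" "\<phi> c \<noteq> u" if "c \<in> L" for c
    using \<phi>L[OF that] v nb_subset[of u] nb_irrefl[of u] by auto
  have less: "\<phi> c < n" if "c \<in> V" for c
    using P(2)[of c] \<phi>V[of c] u(1) that by fastforce
  have inj: "inj_on \<phi> V"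
  proof (rule inj_onI)
    fix c d assume c: "c \<in> V" and d: "d \<in> V" and eq: "\<phi> c = \<phi> d"
    have "c \<in> L \<longleftrightarrow> d \<in> L"
      using P[of c] P[of d] \<phi>V[of c] \<phi>V[of d] c d eq by fastforce
    then show "c = d"
      using eq c d f g by (cases "c \<in> L") (auto simp: \<phi>_def bij_betw_def dest: inj_onD)
  qed
  have "embeds r s (insert {u, v} (join_edges n R)) \<phi>"
    unfolding embeds_def
  proof (intro conjI ballI impI inj)
    fix c d assume c: "c \<in> V" and d: "d \<in> V" and ne: "fst c \<noteq> fst d"
    have neq: "\<phi> c \<noteq> \<phi> d"
      using inj c d ne by (auto dest: inj_onD)
    show "{\<phi> c, \<phi> d} \<in> insert {u, v} (join_edges n R)"
    proof (cases "\<phi> c < S - 1 \<or> \<phi> d < S - 1")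
      case True
      then show ?thesis
        using join_edges_left less[OF c] less[OF d] neq by (metis insertI2)
    next
      case False
      \<comment> \<open>Outside the last part, \<open>u\<close> is the only image that is not a
        joined vertex, so an edge avoiding the joined vertices runs from \<open>u\<close> to
        \<open>v\<close> or to an old neighbour of \<open>u\<close>.\<close>
      have "c \<in> L \<or> d \<in> L"
      proof (rule ccontr)
        assume "\<not> ?thesis"
        then have "\<phi> c = u" "\<phi> d = u"
          using \<phi>V[of c] \<phi>V[of d] c d False by blast+
        then show False
          using neq by simp
      qed
      moreover have "\<not> (c \<in> L \<and> d \<in> L)"
        using ne by (auto simp: L_def)
      ultimately consider "c \<in> L" "\<phi> d = u" | "d \<in> L" "\<phi> c = u"
        using \<phi>V[of c] \<phi>V[of d] c d False by auto
      then show ?thesis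
        using \<phi>L by cases (fastforce simp: nb_def join_edges_def insert_commute)+
    qed
  qed
  then show ?thesis
    by blast
qed

text \<open>The join is extended to a saturated graph. By \<open>join_edges_new_copy\<close> every
  added edge has both ends among the boundedly many vertices of deficient degree.\<close>

lemma saturated_edges_upper:
  "\<exists>C. \<forall>n. \<exists>E. saturated_edge_set r s {..<n} E \<and> 2 * card E \<le> k2 * n + C"
proof -
  \<comment> \<open>This is the bound of \<open>c4_free_almost_regular\<close> for degree
    \<open>t - 1\<close>.\<close>
  define B where "B = t * (t * t)"
  show ?thesis
  proof (rule exI[of _ "2 * (B * B) + 2 * 2 ^ S"], rule allI)
    fix n
    show "\<exists>E. saturated_edge_set r s {..<n} E \<and> 2 * card E \<le> k2 * n + (2 * (B * B) + 2 * 2 ^ S)"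
    \<comment> \<open>For small \<open>n\<close> any saturated graph will do: all its edges are
      subsets of \<open>{..<n}\<close>, so there are at most \<open>2 ^ S\<close> of them.\<close>
    proof (cases "n < S")
      case True
      have "edge_set {..<n} {}"
        by unfold_locales auto
      then obtain E where E: "saturated_edge_set r s {..<n} E"
        using saturated_extension[OF _ not_embeds_empty] by metis
      then have "edge_set {..<n} E"
        by (simp add: saturated_edge_set_def)
      then have "E \<subseteq> Pow {..<n}"
        by (auto dest: edge_set.edge)
      then have "card E \<le> card (Pow {..<n})"
        by (intro card_mono) auto
      also have "\<dots> \<le> 2 ^ S"
        using True by (simp add: card_Pow)
      finally show ?thesis
        using E by (intro exI[of _ E]) simp
    next
      case False
      define P where "P = {S - 1..<n}"
      obtain R where R: "edge_set P R" "c4_free R" "\<And>x. card (nb R x) \<le> t - 1"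
        and "card {x\<in>P. card (nb R x) < t - 1} \<le> Suc (t - 1) * (Suc (t - 1) * Suc (t - 1))"
        using c4_free_almost_regular[of P "t - 1"] by (auto simp: P_def)
      define F where "F = {x\<in>P. card (nb R x) < t - 1}"
      have cardF: "card F \<le> B" and finF: "finite F"
        using \<open>card {x\<in>P. _ x} \<le> _\<close> t_pos by (simp_all add: F_def B_def P_def)
      interpret R: edge_set P R
        by (fact R(1))
      define J where "J = join_edges n R"
      define Q where "Q = {{a, b} | a b. a < S - 1 \<and> b < n \<and> a \<noteq> b}"
      have J_eq: "J = R \<union> Q"
        by (simp add: J_def join_edges_def Q_def)
      have "edge_set {..<n} J"
      proof unfold_locales
        fix e assume "e \<in> J"
        then consider "e \<in> R" | "e \<in> Q"
          by (auto simp: J_eq)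
        then show "e \<subseteq> {..<n} \<and> card e = 2"
        proof cases
          case 1
          then show ?thesis
            using R.edge[of e] by (force simp: P_def)
        next
          case 2
          then show ?thesis
            using False by (auto simp: Q_def)
        qed
      qed simp
      then obtain E where JE: "J \<subseteq> E" and E: "saturated_edge_set r s {..<n} E"
        using saturated_extension join_edges_no_copy[OF R[unfolded P_def]] unfolding J_def by metis
      interpret E: saturated_edge_set r s "{..<n}" E
        by (fact E)
      have "E - J \<subseteq> (\<lambda>(x, y). {x, y}) ` (F \<times> F)"
      proof
        fix e assume e: "e \<in> E - J"
        then obtain x y where xy: "e = {x, y}" "x \<noteq> y" "x < n" "y < n"
          using E.edge[of e] by (auto simp: card_2_iff)
        have "{x, y} \<notin> join_edges n R"
          using e xy(1) by (simp add: J_def)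
        then have P: "x \<in> P" "y \<in> P"
          using join_edges_left[of x y n R] join_edges_left[of y x n R] xy(2-4)
          by (force simp: P_def)+
        \<comment> \<open>An added edge at a vertex of degree \<open>t - 1\<close> in
          \<open>R\<close> would complete a copy inside \<open>E\<close>.\<close>
        have full: "z \<in> F" if z: "z \<in> P" "z' \<in> P" "z' \<noteq> z" "e = {z, z'}" for z z'
        proof (rule ccontr)
          assume "z \<notin> F"
          then have "card (nb R z) = t - 1"
            using z(1) R(3)[of z] by (simp add: F_def)
          moreover have "{z, z'} \<notin> R"
            using e z(4) by (simp add: J_eq)
          ultimately obtain \<phi> where "embeds r s (insert {z, z'} J) \<phi>"
            using join_edges_new_copy[OF R(1)[unfolded P_def]] z(1-3) unfolding P_def J_def by blast
          then have "embeds r s E \<phi>"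
            using JE e z(4) by (elim embeds_mono) auto
          then show False
            using E.no_copy by blast
        qed
        have "x \<in> F" "y \<in> F"
          using full[of x y] full[of y x] P xy by (auto simp: insert_commute)
        then show "e \<in> (\<lambda>(x, y). {x, y}) ` (F \<times> F)"
          using xy(1) by force
      qed
      then have "card (E - J) \<le> card ((\<lambda>(x, y). {x, y}) ` (F \<times> F))"
        using finF by (intro card_mono) auto
      also have "\<dots> \<le> card F * card F"
        using finF by (metis card_cartesian_product card_image_le finite_cartesian_product)
      also have "\<dots> \<le> B * B"
        using cardF by (intro mult_mono) auto
      finally have new: "card (E - J) \<le> B * B" .
      have "Q \<subseteq> (\<lambda>(x, y). {x, y}) ` ({..<S - 1} \<times> {..<n})"
        by (auto simp: Q_def)
      then have "card Q \<le> card ((\<lambda>(x, y). {x, y}) ` ({..<S - 1} \<times> {..<n}))"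
        by (intro card_mono) auto
      also have "\<dots> \<le> (S - 1) * n"
        by (rule order_trans[OF card_image_le]) (auto simp: card_cartesian_product)
      finally have Q: "card Q \<le> (S - 1) * n" .
      have "2 * card R \<le> (\<Sum>x\<in>P. t - 1)"
        unfolding R.sum_degrees[symmetric] using R(3) by (intro sum_mono) auto
      also have "\<dots> \<le> (t - 1) * n"
        by (simp add: P_def mult.commute)
      finally have R_le: "2 * card R \<le> (t - 1) * n" .
      have "card E \<le> card ((R \<union> Q) \<union> (E - J))"
        using E.finite_E R.finite_E finite_subset[OF JE E.finite_E] J_eq by (intro card_mono) auto
      also have "\<dots> \<le> card R + card Q + card (E - J)"
        by (intro order_trans[OF card_Un_le] add_mono card_Un_le) simp
      finally have "2 * card E \<le> 2 * card R + 2 * card Q + 2 * card (E - J)"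
        by simp
      also have "\<dots> \<le> (t - 1) * n + 2 * ((S - 1) * n) + 2 * (B * B)"
        using R_le Q new by (intro add_mono mult_left_mono) auto
      also have "\<dots> = k2 * n + 2 * (B * B)"
        by (simp add: k2_def algebra_simps)
      finally show ?thesis
        using E by (intro exI[of _ E]) simp
    qed
  qed
qed

end

section \<open>Complete multipartite graphs as edge sets\<close>

context part_sizes
begin

lemma complete_multipartite_verts: "verts (complete_multipartite r s) = V"
  by (simp add: complete_multipartite_def multipartite_verts_def Let_def)

lemma complete_multipartite_edge:
  assumes "a \<in> V" "b \<in> V"
  shows "{a, b} \<in> edges (complete_multipartite r s) \<longleftrightarrow> fst a \<noteq> fst b"
proof -
  have "edges (complete_multipartite r s) = {{u, v} | u v. u \<in> V \<and> v \<in> V \<and> fst u \<noteq> fst v}"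
    by (simp add: complete_multipartite_def multipartite_verts_def Let_def)
  then show ?thesis
    using assms by (auto simp: doubleton_eq_iff simp del: split_paired_Ex)
qed

text \<open>An embedding yields the subgraph formed by the images of vertices and edges, with the
  inverse map as isomorphism; its vertices lie in \<open>G\<close> because each has an incident
  edge. Conversely, the inverse of an isomorphism is an embedding.\<close>

lemma free_iff:
  assumes G: "simple_graph G"
  shows "free (complete_multipartite r s) G \<longleftrightarrow> (\<forall>\<phi>. \<not> embeds r s (edges G) \<phi>)"
proof (intro iffI allI notI)
  fix \<phi> assume free: "free (complete_multipartite r s) G" and \<phi>: "embeds r s (edges G) \<phi>"
  have inj: "inj_on \<phi> V"
    using \<phi> by (simp add: embeds_def)
  define H where "H = (\<phi> ` V, {{\<phi> a, \<phi> b} | a b. a \<in> V \<and> b \<in> V \<and> fst a \<noteq> fst b})"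
  have edge_H: "{\<phi> a, \<phi> b} \<in> edges H \<longleftrightarrow> fst a \<noteq> fst b" if ab: "a \<in> V" "b \<in> V" for a b
  proof
    assume "{\<phi> a, \<phi> b} \<in> edges H"
    then obtain c d where cd: "c \<in> V" "d \<in> V" "fst c \<noteq> fst d" "{\<phi> a, \<phi> b} = {\<phi> c, \<phi> d}"
      by (auto simp: H_def)
    then have "\<phi> ` {a, b} = \<phi> ` {c, d}"
      by simp
    then have "{a, b} = {c, d}"
      using inj_on_image_eq_iff[OF inj, of "{a, b}" "{c, d}"] ab cd by simp
    then show "fst a \<noteq> fst b"
      using cd(3) by (auto simp: doubleton_eq_iff)
  qed (use ab in \<open>auto simp: H_def simp del: split_paired_Ex\<close>)
  have "verts H \<subseteq> verts G"
  proof
    fix x assume "x \<in> verts H"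
    then obtain a where a: "a \<in> V" "x = \<phi> a"
      by (auto simp: H_def)
    obtain b where "b \<in> V" "fst a \<noteq> fst b"
      using other_part[OF a(1)] .
    then have "{\<phi> a, \<phi> b} \<in> edges G"
      using \<phi> a(1) by (simp add: embeds_def)
    then show "x \<in> verts G"
      using G a(2) by (auto simp: simple_graph_def)
  qed
  moreover have edges: "edges H \<subseteq> edges G"
    using \<phi> by (auto simp: H_def embeds_def)
  moreover have "simple_graph H"
    unfolding simple_graph_def
  proof (intro conjI ballI)
    show "finite (verts H)"
      by (simp add: H_def)
    fix e assume e: "e \<in> edges H"
    then show "e \<subseteq> verts H"
      by (auto simp: H_def)
    show "card e = 2"
      using e edges G by (auto simp: simple_graph_def)
  qed
  ultimately have "subgraph H G"
    by (simp add: subgraph_def)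
  moreover have "isomorphic H (complete_multipartite r s)"
    unfolding isomorphic_def
  proof (intro exI[of _ "inv_into V \<phi>"] conjI ballI)
    show "bij_betw (inv_into V \<phi>) (verts H) (verts (complete_multipartite r s))"
      unfolding complete_multipartite_verts H_def fst_conv
      by (rule bij_betw_inv_into) (use inj in \<open>simp add: bij_betw_def\<close>)
    fix u v assume "u \<in> verts H" "v \<in> verts H"
    then obtain a b where ab: "a \<in> V" "b \<in> V" "u = \<phi> a" "v = \<phi> b"
      by (auto simp: H_def)
    then show "{u, v} \<in> edges H \<longleftrightarrow>
        {inv_into V \<phi> u, inv_into V \<phi> v} \<in> edges (complete_multipartite r s)"
      using edge_H complete_multipartite_edge inj by simp
  qed
  ultimately show False
    using free unfolding free_def by blast
next
  assume none: "\<forall>\<phi>. \<not> embeds r s (edges G) \<phi>"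
  show "free (complete_multipartite r s) G"
    unfolding free_def
  proof
    assume "\<exists>H. subgraph H G \<and> isomorphic H (complete_multipartite r s)"
    then obtain H f where H: "subgraph H G" and f: "bij_betw f (verts H) V"
      and edge: "\<And>u v. u \<in> verts H \<Longrightarrow> v \<in> verts H \<Longrightarrow>
        {u, v} \<in> edges H \<longleftrightarrow> {f u, f v} \<in> edges (complete_multipartite r s)"
      unfolding isomorphic_def complete_multipartite_verts by blast
    define \<phi> where "\<phi> = inv_into (verts H) f"
    have \<phi>: "bij_betw \<phi> V (verts H)"
      unfolding \<phi>_def using f by (rule bij_betw_inv_into)
    have f\<phi>: "f (\<phi> a) = a" if "a \<in> V" for a
      unfolding \<phi>_def using bij_betw_inv_into_right[OF f that] .
    have "embeds r s (edges G) \<phi>"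
      unfolding embeds_def
    proof (intro conjI ballI impI)
      show "inj_on \<phi> V"
        using \<phi> by (simp add: bij_betw_def)
      fix a b assume ab: "a \<in> V" "b \<in> V" "fst a \<noteq> fst b"
      then have "\<phi> a \<in> verts H" "\<phi> b \<in> verts H"
        using \<phi> by (auto simp: bij_betw_def)
      then have "{\<phi> a, \<phi> b} \<in> edges H"
        using edge ab f\<phi> complete_multipartite_edge by simp
      then show "{\<phi> a, \<phi> b} \<in> edges G"
        using H by (auto simp: subgraph_def)
    qed
    then show False
      using none by blast
  qed
qed

lemma saturated_iff:
  assumes G: "simple_graph G"
  shows "saturated (complete_multipartite r s) G \<longleftrightarrow> saturated_edge_set r s (verts G) (edges G)"
proof -
  have "edge_set (verts G) (edges G)"
    using G by (simp add: edge_set_def simple_graph_def)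
  moreover have "free (complete_multipartite r s) (add_edge G u v) \<longleftrightarrow>
      (\<forall>\<phi>. \<not> embeds r s (insert {u, v} (edges G)) \<phi>)"
    if "u \<in> verts G" "v \<in> verts G" "u \<noteq> v" for u v
  proof -
    have "simple_graph (add_edge G u v)"
      using G that by (auto simp: simple_graph_def add_edge_def)
    then show ?thesis
      using free_iff[of "add_edge G u v"] by (simp add: add_edge_def)
  qed
  ultimately show ?thesis
    using free_iff[OF G] part_sizes_axioms
    by (auto simp: saturated_def saturated_edge_set_def saturated_edge_set_axioms_def)
qed

end

theorem theorem1p1:
  fixes r :: nat and s :: "nat \<Rightarrow> nat"
  assumes "r \<ge> 2"
    and "1 \<le> s 1"
    and "\<forall>i\<in>{1..<r}. s i \<le> s (i + 1)"
  shows "\<exists>C :: real. \<forall>n :: nat.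
    \<bar>real (sat n (complete_multipartite r s))
      - ((\<Sum>i = 1..r - 1. real (s i)) + (real (s r) - 3) / 2) * real n\<bar> \<le> C"
proof -
  \<comment> \<open>Consecutive comparisons are chained to show that the last part is largest and
    every part is nonempty.\<close>
  have mono: "s i \<le> s j" if "i \<le> j" "1 \<le> i" "j \<le> r" for i j
    using that
  proof (induction j rule: dec_induct)
    case (step m)
    then have "s m \<le> s (Suc m)"
      using assms(3) by simp
    then show ?case
      using step by simp
  qed simp
  interpret part_sizes r s
  proof
    show "2 \<le> r"
      by (fact assms(1))
    fix i assume "i \<in> {1..r}"
    then show "1 \<le> s i" "s i \<le> s r"
      using mono[of 1 i] mono[of i r] assms(2) by auto
  qed
  obtain C1 where C1: "\<And>W E. saturated_edge_set r s W (E :: nat set set) \<Longrightarrow>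
      k2 * card W \<le> 2 * card E + C1"
    using saturated_edges_lower by metis
  obtain C2 where C2: "\<And>n. \<exists>E. saturated_edge_set r s {..<n} E \<and> 2 * card E \<le> k2 * n + C2"
    using saturated_edges_upper by metis
  \<comment> \<open>The subtractions of naturals in \<open>k2\<close> do not truncate, since
    \<open>S\<close> and \<open>t\<close> are positive.\<close>
  have k2: "((\<Sum>i = 1..r - 1. real (s i)) + (real (s r) - 3) / 2) = real k2 / 2"
  proof -
    have "real S = (\<Sum>i = 1..r - 1. real (s i))"
      by (simp add: S_def)
    moreover have "real k2 = 2 * (real S - 1) + (real t - 1)"
      using S_pos t_pos by (simp add: k2_def of_nat_diff)
    ultimately show ?thesis
      by (simp add: field_simps)
  qed
  have "\<bar>real (sat n (complete_multipartite r s)) - real k2 / 2 * real n\<bar> \<le> real (C1 + C2)" for n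
  proof -
    define Q where "Q m \<longleftrightarrow> (\<exists>G :: nat graph. simple_graph G \<and> card (verts G) = n \<and>
        saturated (complete_multipartite r s) G \<and> card (edges G) = m)" for m
    have sat: "sat n (complete_multipartite r s) = (LEAST m. Q m)"
      by (simp add: sat_def Q_def)
    obtain E where E: "saturated_edge_set r s {..<n} E" "2 * card E \<le> k2 * n + C2"
      using C2 by blast
    then have "edge_set {..<n} E"
      by (simp add: saturated_edge_set_def)
    then have "simple_graph ({..<n}, E)"
      by (simp add: edge_set_def simple_graph_def)
    \<comment> \<open>This graph serves twice: it bounds the minimum from above, and it shows that
      the minimum is attained, so that the lower bound can be applied to an optimal graph.\<close>
    then have QE: "Q (card E)"
      unfolding Q_def using saturated_iff[of "({..<n}, E)"] E(1)
      by (intro exI[of _ "({..<n}, E)"]) simp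
    then have "sat n (complete_multipartite r s) \<le> card E"
      unfolding sat by (rule Least_le)
    moreover have "Q (sat n (complete_multipartite r s))"
      unfolding sat using QE by (rule LeastI)
    then obtain G :: "nat graph" where G: "simple_graph G" "card (verts G) = n"
        "saturated (complete_multipartite r s) G"
        "card (edges G) = sat n (complete_multipartite r s)"
      unfolding Q_def by (elim exE conjE)
    then have "k2 * n \<le> 2 * sat n (complete_multipartite r s) + C1"
      using C1[of "verts G" "edges G"] saturated_iff[OF G(1)] by simp
    ultimately have "real (2 * sat n (complete_multipartite r s)) \<le> real (k2 * n + C2)"
      "real (k2 * n) \<le> real (2 * sat n (complete_multipartite r s) + C1)"
      using E(2) by linarith+
    then show ?thesis
      by (simp add: abs_le_iff)
  qed
  then show ?thesis
    unfolding k2 by blast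
qed

end
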